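(* Let $k\ge4$ be even. Suppose there exist $C,\alpha_0>0$ such that $\widetilde\rho_k(\alpha)\le\alpha^C$ for all $0<\alpha<\alpha_0$. Then for every $\gamma>1/(C/(2k)-3k/4)$ and all sufficiently large $N$, there exists a $\lceil N^\gamma\rceil$-coloring of $\mathbb{Z}/N\mathbb{Z}$ with no symmetrically colored $k$-AP.
   Context: In $\mathbb{Z}/N\mathbb{Z}$, for even $k$, a $k$-AP $n,n+d,\dots,n+(k-1)d$ with $d\ne0$ is symmetrically colored if $n+(i-1)d$ and $n+(k-i)d$ have the same color for each $i=1,\dots,k/2$. $\mathbb{T}=\mathbb{R}/\mathbb{Z}$. $F\colon\mathbb{T}^2\to[0,1]$ has constant first marginal $\alpha$ if $\int_\mathbb{T}F(x,y)\,dy=\alpha$ for a.e. $x$. $\widetilde\Lambda_k(F)=\mathbb{E}_{(x,y)\in V}\prod_{i=1}^kF(x_i,y_i)$ (Haar measure on $V$), where $V\subset\mathbb{T}^{2k}$ consists of $(x_1,\dots,x_k,y_1,\dots,y_k)$ with $x_2-x_1=\cdots=x_k-x_{k-1}$ and $\sum_{i=1}^k(-1)^i\binom{k-1}{i-1}y_i=0$. $\widetilde\rho_k(\alpha)$ is the infimum of $\widetilde\Lambda_k(F)$ over Riemann integrable $F\colon\mathbb{T}^2\to[0,1]$ with constant first marginal $\alpha$.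
   Formalization: The formal statement adds the assumption C/(2k) − 3k/4 > 0; without it the claim fails (constant F = α allows C = 1, the bound on γ is then negative, and γ = 0 gives one color) or the bound is undefined. *)

theory Defs
  imports "HOL-Probability.Probability"
begin

text \<open>
  The group \<open>\<int>/N\<int>\<close> is represented by the residues \<open>{..<N}\<close>.
\<close>

definition symmetric_AP :: "nat \<Rightarrow> nat \<Rightarrow> (nat \<Rightarrow> nat) \<Rightarrow> nat \<Rightarrow> nat \<Rightarrow> bool" where
  "symmetric_AP N k c n d \<longleftrightarrow>
     (\<forall>i\<in>{1..k div 2}. c ((n + (i - 1) * d) mod N) = c ((n + (k - i) * d) mod N))"

definition has_symmetric_AP :: "nat \<Rightarrow> nat \<Rightarrow> (nat \<Rightarrow> nat) \<Rightarrow> bool" where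
  "has_symmetric_AP N k c \<longleftrightarrow> (\<exists>n<N. \<exists>d<N. d \<noteq> 0 \<and> symmetric_AP N k c n d)"

text \<open>
  A point of \<open>\<real>/\<int>\<close> is represented by its representative in \<open>[0,1)\<close>, a point of the
  \<open>m\<close>-dimensional torus by an extensional function on \<open>{1..m}\<close>. The bijection between
  \<open>[0,1)\<close> and \<open>\<real>/\<int>\<close> identifies the Borel sets.
\<close>

definition torus :: "nat \<Rightarrow> (nat \<Rightarrow> real) set" where
  "torus m = {1..m} \<rightarrow>\<^sub>E {0..<1}"

definition torus_add :: "nat \<Rightarrow> (nat \<Rightarrow> real) \<Rightarrow> (nat \<Rightarrow> real) \<Rightarrow> nat \<Rightarrow> real" where
  "torus_add m u v = (\<lambda>i\<in>{1..m}. frac (u i + v i))"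

text \<open>
  For a closed subgroup \<open>G\<close> of the torus, this is the unique translation-invariant Borel
  probability measure on \<open>G\<close>.
\<close>

definition haar_measure :: "nat \<Rightarrow> (nat \<Rightarrow> real) set \<Rightarrow> (nat \<Rightarrow> real) measure" where
  "haar_measure m G = (THE \<mu>. prob_space \<mu> \<and>
     sets \<mu> = sets (restrict_space (\<Pi>\<^sub>M i\<in>{1..m}. (borel :: real measure)) G) \<and>
     (\<forall>g\<in>G. distr \<mu> \<mu> (torus_add m g) = \<mu>))"

text \<open>
  The coordinates are \<open>x\<^sub>i = v i\<close> and \<open>y\<^sub>i = v (k + i)\<close> for \<open>1 \<le> i \<le> k\<close>;
  an equation in \<open>\<real>/\<int>\<close> becomes membership of a difference of representatives in \<open>\<int>\<close>.
\<close>

definition V :: "nat \<Rightarrow> (nat \<Rightarrow> real) set" where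
  "V k = {v \<in> torus (2 * k).
     (\<forall>i\<in>{1..<k}. (v (i + 1) - v i) - (v 2 - v 1) \<in> \<int>) \<and>
     (\<Sum>i=1..k. (-1) ^ i * real ((k - 1) choose (i - 1)) * v (k + i)) \<in> \<int>}"

text \<open>
  Riemann integrability over a box, in contrast to the Henstock-Kurzweil integrability of the
  library: the gauge has to be uniform.
\<close>

definition riemann_integrable_cbox :: "('a::euclidean_space \<Rightarrow> real) \<Rightarrow> 'a \<Rightarrow> 'a \<Rightarrow> bool" where
  "riemann_integrable_cbox f a b \<longleftrightarrow>
     (\<exists>I. \<forall>e>0. \<exists>\<delta>>0. \<forall>D. D tagged_division_of cbox a b \<and> (\<lambda>x. ball x \<delta>) fine D \<longrightarrow>
        \<bar>(\<Sum>(x,K)\<in>D. measure lborel K * f x) - I\<bar> < e)"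

text \<open>
  A function on the two-dimensional torus is represented by a function on the plane that is
  1-periodic in both variables.
\<close>

definition admissible :: "real \<Rightarrow> (real \<times> real \<Rightarrow> real) \<Rightarrow> bool" where
  "admissible \<alpha> F \<longleftrightarrow>
     (\<forall>x y. F (x + 1, y) = F (x, y) \<and> F (x, y + 1) = F (x, y)) \<and>
     (\<forall>p. 0 \<le> F p \<and> F p \<le> 1) \<and>
     riemann_integrable_cbox F (0, 0) (1, 1) \<and>
     (AE x in lebesgue_on {0..<1}. ((\<lambda>y. F (x, y)) has_integral \<alpha>) {0..1})"

text \<open>
  A Riemann integrable function need not be Borel measurable, so the Haar measure has to be
  completed: the Bochner integral of a non-measurable function is 0 by convention.
\<close>

definition Lambda :: "nat \<Rightarrow> (real \<times> real \<Rightarrow> real) \<Rightarrow> real" where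
  "Lambda k F =
     (\<integral>v. (\<Prod>i=1..k. F (v i, v (k + i))) \<partial>completion (haar_measure (2 * k) (V k)))"

text \<open>Only meaningful for \<open>0 \<le> \<alpha> \<le> 1\<close>; otherwise no \<open>F\<close> is admissible.\<close>

definition rho :: "nat \<Rightarrow> real \<Rightarrow> real" where
  "rho k \<alpha> = (INF F \<in> {F. admissible \<alpha> F}. Lambda k F)"

end

theory Submission
  imports Defs "HOL-Real_Asymp.Real_Asymp" "HOL-Number_Theory.Cong"
begin

text \<open>
  Fix \<open>\<alpha>\<close> and \<open>F\<close> with small \<open>Lambda k F\<close>. For a random real polynomial \<open>P\<close> of degree at most
  \<open>k - 2\<close> and a random rotation \<open>x + n a\<close>, the points \<open>(x + n\<^sub>i a, P n\<^sub>i)\<close> along any nontrivial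
  \<open>k\<close>-AP of integers are exactly Haar distributed on \<open>V k\<close>. The equation of the \<open>y\<^sub>i\<close> has
  coefficients that are antisymmetric under \<open>i \<mapsto> k + 1 - i\<close> since \<open>k\<close> is even, hence this remains
  true after shifting \<open>y\<^sub>i\<close> and \<open>y\<^bsub>k + 1 - i\<^esub>\<close> by a common \<open>t\<close>. Colour \<open>n\<close> by a random
  \<open>c < M = \<alpha>\<^sup>-\<^sup>2\<close> chosen with weights \<open>F (x + n a, P n + t\<^sub>c)\<close>, for independent shifts \<open>t\<^sub>c\<close>. The
  first marginal of \<open>F\<close> bounds the probability that \<open>n\<close> receives no colour, and a union bound over
  the symmetric colour patterns shows that a \<open>k\<close>-AP is symmetrically coloured with probability at
  most about \<open>M\<^bsup>k/2\<^esup> \<alpha>\<^bsup>C\<^esup>\<close>. The product of about \<open>log N\<close> such colourings has no symmetric \<open>k\<close>-AP.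
\<close>

text \<open>Progressions are taken in the integers because a real polynomial is not a function of a
  residue; the price is a factor \<open>2 * k\<close> for colouring by blocks, which excludes
  wrap-around. The law on \<open>V k\<close> is exact for every nonzero difference, not just
  asymptotic in \<open>N\<close>: a homomorphism of tori pushes Haar measure to Haar measure on its
  image, and since slope and coefficients are real, the image is all of \<open>V k\<close>. Without
  the shifts, all colours would have the same weight at a point. With them the \<open>M\<close>
  weights are independent given the rotated point, so a point is uncovered with probability
  \<open>(1 - \<alpha>) ^ M\<close>; the choice of \<open>M\<close> makes this at most
  \<open>exp (- 1 / \<alpha>)\<close>, below every power of \<alpha> for small \<alpha>. The random
  choice of colours is realised by rounding: the bound on bad progressions is affine in each weight,
  so some 0/1 weights do at least as well. With \<open>s = 1 / \<alpha>\<close>, a round spends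
  \<open>s ^ 2 + 1\<close> colours and keeps a fraction of about \<open>s powr (k - C)\<close> of at
  most \<open>2 * N ^ 2\<close> progressions. This costs \<open>N powr (4 / (C - k))\<close> colours
  up to a small change of the exponent, and \<open>4 / (C - k)\<close> is below the bound on
  \<gamma> in the theorem.\<close>

section \<open>Haar measure on closed subgroups of the torus\<close>

text \<open>Keeps the index \<open>1\<close> from being rewritten to \<open>Suc 0\<close>:
  coordinates are numbered from \<open>1\<close>, and facts about them have to match
  syntactically.\<close>

declare One_nat_def [simp del]

lemma frac_eq_frac_iff: "frac x = frac y \<longleftrightarrow> x - y \<in> \<int>" for x y :: real
proof
  assume "frac x = frac y"
  then have "x - y = of_int (\<lfloor>x\<rfloor> - \<lfloor>y\<rfloor>)" by (simp add: frac_def algebra_simps)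
  then show "x - y \<in> \<int>" by simp
next
  assume "x - y \<in> \<int>"
  then obtain n where "x - y = of_int n" by (elim Ints_cases)
  then have "x = y + of_int n" by simp
  then show "frac x = frac y" by (simp add: frac_def)
qed

lemma borel_measurable_frac [measurable (raw)]:
  "f \<in> borel_measurable M \<Longrightarrow> (\<lambda>x. frac (f x :: real)) \<in> borel_measurable M"
  unfolding frac_def
  by (intro borel_measurable_diff measurable_compose[OF _ borel_measurable_real_floor])

section \<open>Rotation invariance on the circle and on the cube\<close>

text \<open>The carrier stays all of \<open>real\<close>, with the mass on \<open>{0..<1}\<close>,
  so that the sigma-algebras below are the plain Borel ones; in return, that a point is a
  representative of its class holds only almost everywhere.\<close>

definition circle :: "real measure" where
  "circle = density lborel (indicator {0..<1})"

lemma sets_circle [measurable_cong, simp]: "sets circle = sets borel"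
  and space_circle [simp]: "space circle = UNIV"
  by (simp_all add: circle_def)

lemma emeasure_circle: "A \<in> sets borel \<Longrightarrow> emeasure circle A = emeasure lborel ({0..<1} \<inter> A)"
  unfolding circle_def
  by (subst emeasure_density) (auto simp: nn_integral_indicator[symmetric] indicator_inter_arith
      simp del: nn_integral_indicator)

lemma AE_circle: "AE x in circle. x \<in> {0..<1}"
  unfolding circle_def by (subst AE_density) (auto intro!: AE_I2 split: split_indicator_asm)

interpretation circle: prob_space circle
  by standard (simp add: emeasure_circle)

text \<open>With \<open>r\<close> the fractional part of \<open>s\<close>, the rotation moves
  \<open>{0..<1 - r}\<close> by \<open>r\<close> and the rest of \<open>{0..<1}\<close> by
  \<open>r - 1\<close>, so that a preimage splits into two translates.\<close>

lemma circle_invariant: "distr circle borel (\<lambda>x. frac (s + x)) = circle"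
proof (rule measure_eqI)
  fix A :: "real set" assume "A \<in> sets (distr circle borel (\<lambda>x. frac (s + x)))"
  then have A [measurable]: "A \<in> sets borel" by simp
  define r where "r = frac s"
  have r: "0 \<le> r" "r < 1" by (simp_all add: r_def frac_lt_1)
  have fr: "frac (s + x) = (if x < 1 - r then r + x else r + x - 1)" if "0 \<le> x" "x < 1" for x
  proof -
    have "frac (s + x) = frac (r + x)" unfolding frac_eq_frac_iff by (simp add: r_def frac_def)
    also have "\<dots> = (if x < 1 - r then r + x else r + x - 1)"
    proof (cases "x < 1 - r")
      case True then show ?thesis using r that by (auto simp: frac_eq)
    next
      case False
      have "frac (r + x) = frac (r + x - 1)" unfolding frac_eq_frac_iff by simp
      also have "\<dots> = r + x - 1" using False r that by (auto simp: frac_eq)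
      finally show ?thesis using False by simp
    qed
    finally show ?thesis .
  qed
  have tr: "emeasure lborel ((\<lambda>x. c + x) -` B) = emeasure lborel B" if "B \<in> sets borel" for B :: "real set" and c :: real
    using lborel_distr_plus[of c] emeasure_distr[of "\<lambda>x. c + x" lborel borel B] that by simp
  let ?B1 = "{r..<1} \<inter> A" and ?B2 = "{0..<r} \<inter> A"
  have split: "{0..<1} \<inter> (\<lambda>x. frac (s + x)) -` A = (\<lambda>x. r + x) -` ?B1 \<union> (\<lambda>x. (r - 1) + x) -` ?B2"
  proof (rule set_eqI)
    fix x :: real
    consider "x < 0" | "1 \<le> x" | "0 \<le> x" "x < 1" by linarith
    then show "x \<in> {0..<1} \<inter> (\<lambda>x. frac (s + x)) -` A \<longleftrightarrow>
        x \<in> (\<lambda>x. r + x) -` ?B1 \<union> (\<lambda>x. (r - 1) + x) -` ?B2"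
    proof cases
      case 3
      have "r - 1 + x = r + x - 1" by simp
      with 3 r show ?thesis unfolding vimage_def by (cases "x < 1 - r") (auto simp: fr[OF 3] \<open>r - 1 + x = r + x - 1\<close>)
    qed (use r in auto)
  qed
  have "emeasure (distr circle borel (\<lambda>x. frac (s + x))) A = emeasure circle ((\<lambda>x. frac (s + x)) -` A)"
    by (subst emeasure_distr) auto
  also have "\<dots> = emeasure lborel ({0..<1} \<inter> (\<lambda>x. frac (s + x)) -` A)"
    by (rule emeasure_circle) (use measurable_sets[of "\<lambda>x. frac (s + x)" borel borel A] in simp)
  also have "\<dots> = emeasure lborel ((\<lambda>x. r + x) -` ?B1) + emeasure lborel ((\<lambda>x. (r - 1) + x) -` ?B2)"
    unfolding split
    by (rule plus_emeasure[symmetric])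
      (use r measurable_sets[of "\<lambda>x. r + x" borel borel ?B1] measurable_sets[of "\<lambda>x. (r-1) + x" borel borel ?B2] in auto)
  also have "\<dots> = emeasure lborel ?B1 + emeasure lborel ?B2"
    using tr[of ?B1 r] tr[of ?B2 "r - 1"] by (simp only: sets.Int A atLeastLessThan_borel)
  also have "\<dots> = emeasure lborel (?B1 \<union> ?B2)"
    by (rule plus_emeasure) auto
  also have "?B1 \<union> ?B2 = {0..<1} \<inter> A" using r by auto
  finally show "emeasure (distr circle borel (\<lambda>x. frac (s + x))) A = emeasure circle A"
    by (simp add: emeasure_circle)
qed simp

definition cube :: "nat \<Rightarrow> (nat \<Rightarrow> real) measure" where
  "cube m = PiM {1..m} (\<lambda>_. circle)"

interpretation circles: product_prob_space "\<lambda>_. circle" I for I :: "nat set"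
  by standard

lemma sets_cube [measurable_cong]: "sets (cube m) = sets (PiM {1..m} (\<lambda>_. borel))"
  unfolding cube_def by (rule sets_PiM_cong) auto

lemma space_cube: "space (cube m) = extensional {1..m}"
  by (simp add: cube_def space_PiM PiE_def)

interpretation cube: prob_space "cube m" for m
  unfolding cube_def by (rule prob_space_PiM) (rule circle.prob_space_axioms)

lemma measurable_torus_add [measurable]:
  "torus_add m s \<in> measurable (cube m) (cube m)"
  unfolding torus_add_def cube_def
  by (rule measurable_restrict) (use borel_measurable_frac in measurable)

lemma cube_invariant: "distr (cube m) (cube m) (torus_add m s) = cube m"
  unfolding cube_def
proof (rule circles.PiM_eqI)
  fix A :: "nat \<Rightarrow> real set" assume A: "\<And>i. i \<in> {1..m} \<Longrightarrow> A i \<in> sets circle"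
  let ?M = "PiM {1..m} (\<lambda>_. circle)"
  have [measurable]: "torus_add m s \<in> measurable ?M ?M"
    using measurable_torus_add by (simp add: cube_def)
  have 1: "(\<lambda>x. frac (s i + x)) -` A i \<in> sets circle" if "i \<in> {1..m}" for i
    using A[OF that] measurable_sets[of "\<lambda>x. frac (s i + x)" borel borel "A i"] by simp
  have "emeasure (distr ?M ?M (torus_add m s)) (Pi\<^sub>E {1..m} A) =
      emeasure ?M (torus_add m s -` (Pi\<^sub>E {1..m} A) \<inter> space ?M)"
    by (rule emeasure_distr) (auto intro!: sets_PiM_I_finite A)
  also have "torus_add m s -` (Pi\<^sub>E {1..m} A) \<inter> space ?M = Pi\<^sub>E {1..m} (\<lambda>i. (\<lambda>x. frac (s i + x)) -` A i)"
    by (auto simp: space_PiM torus_add_def PiE_iff extensional_def)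
  also have "emeasure ?M \<dots> = (\<Prod>i\<in>{1..m}. emeasure circle ((\<lambda>x. frac (s i + x)) -` A i))"
    by (rule circles.emeasure_PiM) (use 1 in auto)
  also have "\<dots> = (\<Prod>i\<in>{1..m}. emeasure circle (A i))"
  proof (rule prod.cong[OF refl])
    fix i assume "i \<in> {1..m}"
    then have Ai: "A i \<in> sets borel" using A by simp
    have "emeasure circle (A i) = emeasure (distr circle borel (\<lambda>x. frac (s i + x))) (A i)"
      by (simp add: circle_invariant)
    also have "\<dots> = emeasure circle ((\<lambda>x. frac (s i + x)) -` A i)"
      by (subst emeasure_distr) (use Ai in auto)
    finally show "emeasure circle ((\<lambda>x. frac (s i + x)) -` A i) = emeasure circle (A i)" ..
  qed
  finally show "emeasure (distr ?M ?M (torus_add m s)) (Pi\<^sub>E {1..m} A) = (\<Prod>i\<in>{1..m}. emeasure circle (A i))" .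
qed auto

section \<open>Integer matrices as homomorphisms of tori, and their push-forwards\<close>

text \<open>Integrality of the entries makes the real linear map descend to a homomorphism of tori.
  The argument \<open>w\<close> may be any real vector, not only a representative, so that preimages
  can be found by dividing in the reals.\<close>

definition torus_hom :: "nat \<Rightarrow> nat \<Rightarrow> (nat \<Rightarrow> nat \<Rightarrow> int) \<Rightarrow> (nat \<Rightarrow> real) \<Rightarrow> nat \<Rightarrow> real" where
  "torus_hom K m a w = (\<lambda>j\<in>{1..m}. frac (\<Sum>i=1..K. of_int (a j i) * w i))"

text \<open>The integers discarded by \<open>torus_add\<close> are multiplied by integer entries and
  hence vanish modulo 1.\<close>

lemma torus_hom_add:
  "torus_hom K m a (torus_add K s w) = torus_add m (torus_hom K m a s) (torus_hom K m a w)"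
proof
  fix j
  have "frac (\<Sum>i=1..K. of_int (a j i) * torus_add K s w i) =
      frac (frac (\<Sum>i=1..K. of_int (a j i) * s i) + frac (\<Sum>i=1..K. of_int (a j i) * w i))"
    unfolding frac_eq_frac_iff
  proof -
    have "(\<Sum>i=1..K. of_int (a j i) * torus_add K s w i) =
        (\<Sum>i=1..K. of_int (a j i) * s i) + (\<Sum>i=1..K. of_int (a j i) * w i)
         - (\<Sum>i=1..K. of_int (a j i) * of_int \<lfloor>s i + w i\<rfloor>)"
      unfolding sum.distrib[symmetric] sum_subtractf[symmetric]
      by (rule sum.cong) (simp_all add: torus_add_def frac_def right_diff_distrib distrib_left)
    then have "(\<Sum>i=1..K. of_int (a j i) * torus_add K s w i) -
       (frac (\<Sum>i=1..K. of_int (a j i) * s i) + frac (\<Sum>i=1..K. of_int (a j i) * w i)) =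
       of_int (- (\<Sum>i=1..K. a j i * \<lfloor>s i + w i\<rfloor>) + \<lfloor>\<Sum>i=1..K. of_int (a j i) * s i\<rfloor> + \<lfloor>\<Sum>i=1..K. of_int (a j i) * w i\<rfloor>)"
      unfolding frac_def by (simp only: of_int_add of_int_minus of_int_sum of_int_mult)
    then show "(\<Sum>i=1..K. of_int (a j i) * torus_add K s w i) -
       (frac (\<Sum>i=1..K. of_int (a j i) * s i) + frac (\<Sum>i=1..K. of_int (a j i) * w i)) \<in> \<int>"
      by (simp only: Ints_of_int)
  qed
  then show "torus_hom K m a (torus_add K s w) j = torus_add m (torus_hom K m a s) (torus_hom K m a w) j"
    by (simp add: torus_hom_def torus_add_def)
qed

lemma measurable_cube_component [measurable]:
  assumes "i \<in> {1..K}"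
  shows "(\<lambda>x. x i) \<in> borel_measurable (cube K)"
  using measurable_component_singleton[OF assms, of "\<lambda>_. circle"]
  by (simp add: cube_def measurable_cong_sets[OF refl sets_circle])

lemma measurable_torus_hom [measurable]: "torus_hom K m a \<in> measurable (cube K) (PiM {1..m} (\<lambda>_. borel))"
  unfolding torus_hom_def
proof (rule measurable_restrict)
  fix j
  show "(\<lambda>x. frac (\<Sum>i = 1..K. real_of_int (a j i) * x i)) \<in> borel_measurable (cube K)"
    by (intro borel_measurable_frac borel_measurable_sum borel_measurable_times measurable_const
        measurable_cube_component) simp_all
qed

abbreviation sub_borel :: "nat \<Rightarrow> (nat \<Rightarrow> real) set \<Rightarrow> (nat \<Rightarrow> real) measure" where
  "sub_borel m G \<equiv> restrict_space (PiM {1..m} (\<lambda>_. borel)) G"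

lemma space_sub_borel: "G \<subseteq> torus m \<Longrightarrow> space (sub_borel m G) = G"
  by (auto simp: space_restrict_space space_PiM torus_def PiE_def)

text \<open>Joint measurability is what Fubini needs in the uniqueness proof; a single translation
  is measurable as a section of it.\<close>

lemma measurable_torus_add_pair:
  assumes "\<And>g h. g \<in> G \<Longrightarrow> h \<in> G \<Longrightarrow> torus_add m g h \<in> G" and "G \<subseteq> torus m"
  shows "(\<lambda>(g, h). torus_add m g h) \<in> measurable (sub_borel m G \<Otimes>\<^sub>M sub_borel m G) (sub_borel m G)"
proof (rule measurable_restrict_space2)
  show "(\<lambda>(g, h). torus_add m g h) \<in> space (sub_borel m G \<Otimes>\<^sub>M sub_borel m G) \<rightarrow> G"
    using assms(1) by (auto simp: space_pair_measure space_sub_borel[OF assms(2)])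
  have c: "(\<lambda>g. g i) \<in> borel_measurable (sub_borel m G)" if "i \<in> {1..m}" for i
    by (rule measurable_restrict_space1) (use that in measurable)
  show "(\<lambda>(g, h). torus_add m g h) \<in> measurable (sub_borel m G \<Otimes>\<^sub>M sub_borel m G) (PiM {1..m} (\<lambda>_. borel))"
    unfolding torus_add_def split_beta
    by (rule measurable_restrict, intro borel_measurable_frac borel_measurable_add)
      (auto intro!: measurable_compose[OF measurable_fst c] measurable_compose[OF measurable_snd c])
qed

lemma torus_add_commute: "torus_add m u v = torus_add m v u"
  by (simp add: torus_add_def add.commute)

text \<open>Integrate the indicator of \<open>A\<close> at the sum of \<open>g\<close> and
  \<open>h\<close> over the product of both measures. By invariance, integrating over
  \<open>h\<close> first leaves the \<nu>-measure of \<open>A\<close>; integrating over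
  \<open>g\<close> first leaves its \<mu>-measure, by commutativity.\<close>

lemma invariant_measure_unique:
  assumes clo: "\<And>g h. g \<in> G \<Longrightarrow> h \<in> G \<Longrightarrow> torus_add m g h \<in> G" and G: "G \<subseteq> torus m"
    and mu: "prob_space \<mu>" "sets \<mu> = sets (sub_borel m G)" "\<And>g. g \<in> G \<Longrightarrow> distr \<mu> \<mu> (torus_add m g) = \<mu>"
    and nu: "prob_space \<nu>" "sets \<nu> = sets (sub_borel m G)" "\<And>g. g \<in> G \<Longrightarrow> distr \<nu> \<nu> (torus_add m g) = \<nu>"
  shows "\<mu> = \<nu>"
proof (rule measure_eqI)
  show "sets \<mu> = sets \<nu>" using mu nu by simp
  interpret mu: prob_space \<mu> by fact
  interpret nu: prob_space \<nu> by fact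
  interpret pair_prob_space \<mu> \<nu> ..
  have sp: "space \<mu> = G" "space \<nu> = G"
    using sets_eq_imp_space_eq[OF mu(2)] sets_eq_imp_space_eq[OF nu(2)] space_sub_borel[OF G] by simp_all
  note meas = measurable_torus_add_pair[OF clo G]
  have m1 [measurable]: "(\<lambda>(g, h). torus_add m g h) \<in> measurable (\<mu> \<Otimes>\<^sub>M \<nu>) \<mu>"
    using meas measurable_cong_sets[OF sets_pair_measure_cong[OF mu(2) nu(2)] mu(2)] by simp
  have t: "torus_add m g \<in> measurable \<mu> \<mu>" "torus_add m g \<in> measurable \<nu> \<nu>" if "g \<in> G" for g
  proof -
    have "(\<lambda>h. (g, h)) \<in> measurable (sub_borel m G) (sub_borel m G \<Otimes>\<^sub>M sub_borel m G)"
      using that space_sub_borel[OF G] by (intro measurable_Pair1') auto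
    from measurable_compose[OF this meas] have "torus_add m g \<in> measurable (sub_borel m G) (sub_borel m G)"
      by simp
    then show "torus_add m g \<in> measurable \<mu> \<mu>" "torus_add m g \<in> measurable \<nu> \<nu>"
      using measurable_cong_sets[OF mu(2) mu(2)] measurable_cong_sets[OF nu(2) nu(2)] by simp_all
  qed
  fix A assume A [measurable]: "A \<in> sets \<mu>"
  then have A' [measurable]: "A \<in> sets \<nu>" using mu nu by simp
  let ?f = "\<lambda>g h. indicator A (torus_add m g h) :: ennreal"
  have mf: "(\<lambda>(g, h). ?f g h) \<in> borel_measurable (\<mu> \<Otimes>\<^sub>M \<nu>)"
    using measurable_compose[OF m1 borel_measurable_indicator[OF A]] by (simp add: split_beta')
  have i\<mu>: "(\<integral>\<^sup>+ h. ?f g h \<partial>\<mu>) = emeasure \<mu> A" if "g \<in> G" for g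
  proof -
    have "emeasure \<mu> A = emeasure (distr \<mu> \<mu> (torus_add m g)) A" using mu(3)[OF that] by simp
    also have "\<dots> = (\<integral>\<^sup>+ x. indicator A x \<partial>distr \<mu> \<mu> (torus_add m g))" by simp
    also have "\<dots> = (\<integral>\<^sup>+ h. ?f g h \<partial>\<mu>)"
      by (rule nn_integral_distr) (use t[OF that] in auto)
    finally show ?thesis ..
  qed
  have i\<nu>: "(\<integral>\<^sup>+ h. ?f g h \<partial>\<nu>) = emeasure \<nu> A" if "g \<in> G" for g
  proof -
    have "emeasure \<nu> A = emeasure (distr \<nu> \<nu> (torus_add m g)) A" using nu(3)[OF that] by simp
    also have "\<dots> = (\<integral>\<^sup>+ x. indicator A x \<partial>distr \<nu> \<nu> (torus_add m g))" using A' by simp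
    also have "\<dots> = (\<integral>\<^sup>+ h. ?f g h \<partial>\<nu>)"
      by (rule nn_integral_distr) (use t[OF that] A' in auto)
    finally show ?thesis ..
  qed
  have "emeasure \<nu> A = (\<integral>\<^sup>+ g. emeasure \<nu> A \<partial>\<mu>)" by (simp add: mu.emeasure_space_1)
  also have "\<dots> = (\<integral>\<^sup>+ g. (\<integral>\<^sup>+ h. ?f g h \<partial>\<nu>) \<partial>\<mu>)"
    by (rule nn_integral_cong) (simp add: sp i\<nu>)
  also have "\<dots> = (\<integral>\<^sup>+ h. (\<integral>\<^sup>+ g. ?f g h \<partial>\<mu>) \<partial>\<nu>)"
    by (rule Fubini'[OF mf, symmetric])
  also have "\<dots> = (\<integral>\<^sup>+ h. emeasure \<mu> A \<partial>\<nu>)"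
  proof (rule nn_integral_cong)
    fix h assume "h \<in> space \<nu>"
    then have "h \<in> G" by (simp add: sp)
    from i\<mu>[OF this] show "(\<integral>\<^sup>+ g. ?f g h \<partial>\<mu>) = emeasure \<mu> A"
      by (subst torus_add_commute)
  qed
  also have "\<dots> = emeasure \<mu> A" by (simp add: nu.emeasure_space_1)
  finally show "emeasure \<mu> A = emeasure \<nu> A" ..
qed

text \<open>Translation by the image of \<open>s\<close> lifts to translation by \<open>s\<close> on
  the cube, so the push-forward is invariant; uniqueness then identifies it with the measure
  described by \<open>THE\<close>.\<close>

theorem haar_measure_torus_hom:
  assumes "range (torus_hom K m a) = G"
  shows "haar_measure m G = distr (cube K) (sub_borel m G) (torus_hom K m a)"
proof -
  let ?\<phi> = "torus_hom K m a"
  let ?\<mu> = "distr (cube K) (sub_borel m G) ?\<phi>"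
  have G: "G \<subseteq> torus m"
    unfolding assms[symmetric] by (auto simp: torus_hom_def torus_def frac_lt_1)
  have clo: "torus_add m g h \<in> G" if "g \<in> G" "h \<in> G" for g h
  proof -
    from that obtain s t where "g = torus_hom K m a s" "h = torus_hom K m a t"
      unfolding assms[symmetric] by blast
    then have "torus_add m g h = torus_hom K m a (torus_add K s t)" by (simp only: torus_hom_add)
    then show ?thesis unfolding assms[symmetric] by simp
  qed
  have phi [measurable]: "?\<phi> \<in> measurable (cube K) (sub_borel m G)"
    by (rule measurable_restrict_space2) (use assms in auto)
  have p: "prob_space ?\<mu>" by (rule cube.prob_space_distr) fact
  have inv: "distr ?\<mu> ?\<mu> (torus_add m g) = ?\<mu>" if g: "g \<in> G" for g
  proof -
    from g obtain s where s: "g = ?\<phi> s" unfolding assms[symmetric] by auto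
    have "(\<lambda>h. (g, h)) \<in> measurable (sub_borel m G) (sub_borel m G \<Otimes>\<^sub>M sub_borel m G)"
      using g space_sub_borel[OF G] by (intro measurable_Pair1') auto
    from measurable_compose[OF this measurable_torus_add_pair[OF clo G]]
    have t: "torus_add m g \<in> measurable (sub_borel m G) (sub_borel m G)" by simp
    have "distr ?\<mu> ?\<mu> (torus_add m g) = distr ?\<mu> (sub_borel m G) (torus_add m g)"
      by (rule distr_cong) simp_all
    also have "\<dots> = distr (cube K) (sub_borel m G) (torus_add m g \<circ> ?\<phi>)"
      using t phi by (intro distr_distr) simp_all
    also have "torus_add m g \<circ> ?\<phi> = ?\<phi> \<circ> torus_add K s"
      by (simp add: fun_eq_iff torus_hom_add s)
    also have "distr (cube K) (sub_borel m G) (?\<phi> \<circ> torus_add K s)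
        = distr (distr (cube K) (cube K) (torus_add K s)) (sub_borel m G) ?\<phi>"
      using phi by (intro distr_distr[symmetric]) simp_all
    also have "\<dots> = ?\<mu>" by (simp add: cube_invariant)
    finally show ?thesis .
  qed
  show ?thesis
    unfolding haar_measure_def
  proof (rule the_equality)
    show "prob_space ?\<mu> \<and> sets ?\<mu> = sets (sub_borel m G) \<and> (\<forall>g\<in>G. distr ?\<mu> ?\<mu> (torus_add m g) = ?\<mu>)"
      using p inv by (simp only: sets_distr simp_thms) blast
  next
    fix \<nu> assume *: "prob_space \<nu> \<and> sets \<nu> = sets (sub_borel m G) \<and> (\<forall>g\<in>G. distr \<nu> \<nu> (torus_add m g) = \<nu>)"
    show "\<nu> = ?\<mu>"
      by (rule invariant_measure_unique[OF clo G _ _ _ p sets_distr inv]) (use * in blast)+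
  qed
qed


section \<open>Random polynomials along arithmetic progressions\<close>

text \<open>Pascal's rule, read as: up to sign, a difference of order \<open>m + 1\<close> is the
  difference of order \<open>m\<close> of a first difference.\<close>

lemma alternating_binomial_sum_Suc:
  fixes f :: "nat \<Rightarrow> 'a::comm_ring_1"
  shows "(\<Sum>i\<le>Suc m. (-1) ^ i * of_nat (Suc m choose i) * f i) =
    (\<Sum>i\<le>m. (-1) ^ i * of_nat (m choose i) * f i) - (\<Sum>i\<le>m. (-1) ^ i * of_nat (m choose i) * f (Suc i))"
proof -
  have "(\<Sum>i\<le>Suc m. (-1) ^ i * of_nat (Suc m choose i) * f i) =
      f 0 + (\<Sum>i\<le>m. (-1) ^ Suc i * of_nat (Suc m choose Suc i) * f (Suc i))"
    by (subst sum.atMost_Suc_shift) simp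
  also have "(\<Sum>i\<le>m. (-1) ^ Suc i * of_nat (Suc m choose Suc i) * f (Suc i)) =
      - (\<Sum>i\<le>m. (-1) ^ i * of_nat (m choose i) * f (Suc i))
      + (\<Sum>i\<le>m. (-1) ^ Suc i * of_nat (m choose Suc i) * f (Suc i))"
    unfolding sum_negf[symmetric] sum.distrib[symmetric]
    by (rule sum.cong) (simp_all add: algebra_simps)
  also have "f 0 + (- (\<Sum>i\<le>m. (-1) ^ i * of_nat (m choose i) * f (Suc i))
      + (\<Sum>i\<le>m. (-1) ^ Suc i * of_nat (m choose Suc i) * f (Suc i))) =
      (\<Sum>i\<le>Suc m. (-1) ^ i * of_nat (m choose i) * f i)
      - (\<Sum>i\<le>m. (-1) ^ i * of_nat (m choose i) * f (Suc i))"
    by (subst sum.atMost_Suc_shift) simp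
  finally show ?thesis by (simp add: binomial_eq_0)
qed

text \<open>A difference of order \<open>m\<close> kills polynomials of degree below
  \<open>m\<close>: the first difference of an \<open>l\<close>-th power is a combination of lower
  powers, to which the induction hypothesis applies.\<close>

lemma alternating_binomial_sum_power:
  fixes a d :: "'a::comm_ring_1"
  assumes "l < m"
  shows "(\<Sum>i\<le>m. (-1) ^ i * of_nat (m choose i) * (a + of_nat i * d) ^ l) = 0"
  using assms
proof (induction m arbitrary: l)
  case (Suc m)
  let ?S = "\<lambda>f. \<Sum>i\<le>m. (-1) ^ i * of_nat (m choose i) * (f i :: 'a)"
  have "(a + of_nat (Suc i) * d) ^ l - (a + of_nat i * d) ^ l =
      (\<Sum>j<l. of_nat (l choose j) * d ^ (l - j) * (a + of_nat i * d) ^ j)" for i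
  proof -
    have "(a + of_nat (Suc i) * d) ^ l = ((a + of_nat i * d) + d) ^ l"
      by (simp add: algebra_simps)
    also have "\<dots> = (\<Sum>j\<le>l. of_nat (l choose j) * (a + of_nat i * d) ^ j * d ^ (l - j))"
      by (rule binomial_ring)
    also have "\<dots> = (\<Sum>j<l. of_nat (l choose j) * (a + of_nat i * d) ^ j * d ^ (l - j)) + (a + of_nat i * d) ^ l"
      by (simp add: lessThan_Suc_atMost[symmetric])
    finally show ?thesis by (simp add: algebra_simps)
  qed
  then have e: "(a + of_nat i * d) ^ l - (a + of_nat (Suc i) * d) ^ l =
      - (\<Sum>j<l. of_nat (l choose j) * d ^ (l - j) * (a + of_nat i * d) ^ j)" for i
    by (metis minus_diff_eq)
  have "?S (\<lambda>i. (a + of_nat i * d) ^ l) - ?S (\<lambda>i. (a + of_nat (Suc i) * d) ^ l) =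
      ?S (\<lambda>i. (a + of_nat i * d) ^ l - (a + of_nat (Suc i) * d) ^ l)"
    by (simp only: right_diff_distrib sum_subtractf)
  also have "\<dots> = - ?S (\<lambda>i. \<Sum>j<l. of_nat (l choose j) * d ^ (l - j) * (a + of_nat i * d) ^ j)"
    unfolding e by (simp add: sum_negf)
  also have "?S (\<lambda>i. \<Sum>j<l. of_nat (l choose j) * d ^ (l - j) * (a + of_nat i * d) ^ j) =
      (\<Sum>j<l. of_nat (l choose j) * d ^ (l - j) * ?S (\<lambda>i. (a + of_nat i * d) ^ j))"
    unfolding sum_distrib_left by (subst sum.swap) (simp add: ac_simps)
  also have "\<dots> = 0"
    by (rule sum.neutral) (use Suc in auto)
  finally show ?case by (subst alternating_binomial_sum_Suc) simp
qed simp

text \<open>Newton interpolation: a new node is served by adding a multiple of the polynomial that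
  vanishes at the earlier nodes.\<close>

lemma interpolation_exists:
  fixes z :: "nat \<Rightarrow> 'a::field"
  assumes "inj_on z {..<m}"
  shows "\<exists>b. \<forall>i<m. (\<Sum>l<m. z i ^ l * b l) = y i"
proof -
  \<comment> \<open>The bound \<open>degree p < m\<close> cannot hold for \<open>m = 0\<close>,
    where the zero polynomial is demanded instead.\<close>
  have "\<exists>p. degree p < Suc m \<and> (m = 0 \<longrightarrow> p = 0) \<and> (m > 0 \<longrightarrow> degree p < m) \<and> (\<forall>i<m. poly p (z i) = y i)"
    using assms
  proof (induction m)
    case 0 then show ?case by (intro exI[of _ 0]) auto
  next
    case (Suc m)
    then obtain p where p: "m = 0 \<longrightarrow> p = 0" "m > 0 \<longrightarrow> degree p < m" "\<forall>i<m. poly p (z i) = y i"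
      by (auto simp: lessThan_Suc)
    define q where "q = (\<Prod>i<m. [:- z i, 1:])"
    have q0: "poly q (z i) = 0" if "i < m" for i using that by (auto simp: q_def poly_prod)
    have "z m \<noteq> z i" if "i < m" for i using inj_onD[OF Suc.prems, of m i] that by auto
    then have qm: "poly q (z m) \<noteq> 0" by (auto simp: q_def poly_prod)
    have dq: "degree q \<le> m"
    proof -
      have "degree q \<le> sum (degree \<circ> (\<lambda>i. [:- z i, 1:])) {..<m}"
        unfolding q_def by (rule degree_prod_sum_le) simp
      then show ?thesis by simp
    qed
    define p' where "p' = p + smult ((y m - poly p (z m)) / poly q (z m)) q"
    have "degree p' \<le> m" unfolding p'_def
      using p dq by (intro degree_add_le) (cases "m = 0", auto intro: order.trans[OF degree_smult_le])
    moreover have "\<forall>i<Suc m. poly p' (z i) = y i"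
      using p(3) q0 qm by (auto simp: p'_def less_Suc_eq)
    ultimately show ?case by (intro exI[of _ p']) auto
  qed
  then obtain p where p: "m > 0 \<longrightarrow> degree p < m" "\<forall>i<m. poly p (z i) = y i" by auto
  have "(\<Sum>l<m. z i ^ l * coeff p l) = y i" if "i < m" for i
  proof -
    have "poly p (z i) = (\<Sum>l\<le>degree p. coeff p l * z i ^ l)" by (rule poly_altdef)
    also have "\<dots> = (\<Sum>l<m. coeff p l * z i ^ l)"
      using p(1) that by (intro sum.mono_neutral_left) (auto intro: le_less_trans simp: coeff_eq_0)
    finally show ?thesis using p(2) that by (simp add: mult.commute)
  qed
  then show ?thesis by (intro exI[of _ "coeff p"]) auto
qed

section \<open>Parametrisation of \<open>V k\<close> by an integer matrix\<close>

text \<open>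
  The coordinates of a parameter vector \<open>w\<close> are a base point and a slope (1 and 2), the \<open>k - 1\<close>
  coefficients of a polynomial (3 to \<open>k + 1\<close>) and the shifts (\<open>k + 2 + c\<close> for the colour \<open>c\<close>).
  The rows below express the value at the integer \<open>z\<close> of the linear form and of the polynomial
  shifted by the coordinate of \<open>c\<close>.
\<close>

definition x_row :: "int \<Rightarrow> nat \<Rightarrow> int" where
  "x_row z j = (if j = 1 then 1 else if j = 2 then z else 0)"

definition y_row :: "nat \<Rightarrow> int \<Rightarrow> nat \<Rightarrow> nat \<Rightarrow> int" where
  "y_row k z c j = (if j \<in> {3..k + 1} then z ^ (j - 3) else if j = k + 2 + c then 1 else 0)"

definition x_val :: "(nat \<Rightarrow> real) \<Rightarrow> int \<Rightarrow> real" where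
  "x_val w z = w 1 + of_int z * w 2"

definition y_val :: "nat \<Rightarrow> (nat \<Rightarrow> real) \<Rightarrow> int \<Rightarrow> nat \<Rightarrow> real" where
  "y_val k w z c = (\<Sum>l<k - 1. of_int z ^ l * w (3 + l)) + w (k + 2 + c)"

lemma sum_x_row:
  assumes "2 \<le> K"
  shows "(\<Sum>j=1..K. of_int (x_row z j) * w j) = x_val w z"
proof -
  have "(\<Sum>j=1..K. of_int (x_row z j) * w j) = (\<Sum>j\<in>{1, 2}. of_int (x_row z j) * w j)"
    using assms by (intro sum.mono_neutral_right) (auto simp: x_row_def)
  then show ?thesis by (simp add: x_row_def x_val_def)
qed

lemma sum_y_row:
  assumes "k \<ge> 1" "c < M"
  shows "(\<Sum>j=1..k + 1 + M. of_int (y_row k z c j) * w j) = y_val k w z c"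
proof -
  have "(\<Sum>j=1..k + 1 + M. of_int (y_row k z c j) * w j) =
      (\<Sum>j\<in>insert (k + 2 + c) {3..k + 1}. of_int (y_row k z c j) * w j)"
    using assms by (intro sum.mono_neutral_right) (auto simp: y_row_def)
  also have "\<dots> = w (k + 2 + c) + (\<Sum>j\<in>{3..k + 1}. of_int z ^ (j - 3) * w j)"
    by (simp add: y_row_def)
  also have "(\<Sum>j\<in>{3..k + 1}. of_int z ^ (j - 3) * w j) = (\<Sum>l<k - 1. of_int z ^ l * w (3 + l))"
    by (rule sum.reindex_bij_witness[of _ "\<lambda>l. 3 + l" "\<lambda>j. j - 3"]) (use assms in auto)
  finally show ?thesis by (simp add: y_val_def)
qed

definition AP_matrix :: "nat \<Rightarrow> (nat \<Rightarrow> int) \<Rightarrow> (nat \<Rightarrow> nat) \<Rightarrow> nat \<Rightarrow> nat \<Rightarrow> int" where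
  "AP_matrix k z \<sigma> j = (if j \<le> k then x_row (z j) else y_row k (z (j - k)) (\<sigma> (j - k)))"

lemma torus_hom_AP_matrix:
  assumes "k \<ge> 1" "\<And>i. i \<in> {1..k} \<Longrightarrow> \<sigma> i < M" "i \<in> {1..k}"
  shows "torus_hom (k + 1 + M) (2 * k) (AP_matrix k z \<sigma>) w i = frac (x_val w (z i))"
    and "torus_hom (k + 1 + M) (2 * k) (AP_matrix k z \<sigma>) w (k + i) = frac (y_val k w (z i) (\<sigma> i))"
proof -
  show "torus_hom (k + 1 + M) (2 * k) (AP_matrix k z \<sigma>) w i = frac (x_val w (z i))"
    using assms sum_x_row[of "k + 1 + M" "z i" w] by (auto simp: torus_hom_def AP_matrix_def)
  show "torus_hom (k + 1 + M) (2 * k) (AP_matrix k z \<sigma>) w (k + i) = frac (y_val k w (z i) (\<sigma> i))"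
    using assms sum_y_row[of k "\<sigma> i" M "z i" w] by (auto simp: torus_hom_def AP_matrix_def)
qed

lemma frac_diff_Ints: "frac x - x \<in> \<int>" for x :: real
  by (simp add: frac_def)

text \<open>The reflection of \<open>i\<close> to \<open>k + 1 - i\<close> preserves the binomial
  coefficient and, as \<open>k + 1\<close> is odd, flips the sign, so the sum is its own negative.
  This is what lets symmetric points carry a common shift.\<close>

lemma binomial_weights_antisym:
  fixes \<tau> :: "nat \<Rightarrow> real"
  assumes "even k" "\<And>i. i \<in> {1..k} \<Longrightarrow> \<tau> (k + 1 - i) = \<tau> i"
  shows "(\<Sum>i=1..k. (-1) ^ i * real ((k - 1) choose (i - 1)) * \<tau> i) = 0"
proof -
  let ?g = "\<lambda>i. (-1) ^ i * real ((k - 1) choose (i - 1)) * \<tau> i"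
  have "(\<Sum>i=1..k. ?g i) = (\<Sum>i=1..k. ?g (k + 1 - i))"
    by (rule sum.atLeastAtMost_rev)
  also have "\<dots> = (\<Sum>i=1..k. - ?g i)"
  proof (rule sum.cong[OF refl])
    fix i assume i: "i \<in> {1..k}"
    have "even (k + 1 - i) \<longleftrightarrow> odd i" using assms(1) i by auto
    then have s: "(-1 :: real) ^ (k + 1 - i) = - ((-1) ^ i)"
      by (cases "even i") simp_all
    have "(k - 1) choose (k + 1 - i - 1) = (k - 1) choose (i - 1)"
    proof -
      have "i - 1 \<le> k - 1" "k - 1 - (i - 1) = k + 1 - i - 1" using i by auto
      then show ?thesis using binomial_symmetric[of "i - 1" "k - 1"] by simp
    qed
    then show "?g (k + 1 - i) = - ?g i" using s assms(2)[OF i] by simp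
  qed
  also have "\<dots> = - (\<Sum>i=1..k. ?g i)" by (rule sum_negf)
  finally show ?thesis by simp
qed

text \<open>Up to sign this is a difference of order \<open>k - 1\<close> of a polynomial of degree
  at most \<open>k - 2\<close>.\<close>

lemma binomial_weights_poly:
  fixes b :: "nat \<Rightarrow> real" and n d :: int
  assumes "k \<ge> 1" and z: "\<And>i. z i = n + (int i - 1) * d"
  shows "(\<Sum>i=1..k. (-1) ^ i * real ((k - 1) choose (i - 1)) * (\<Sum>l<k - 1. of_int (z i) ^ l * b l)) = 0"
proof -
  have "(\<Sum>i=1..k. (-1) ^ i * real ((k - 1) choose (i - 1)) * (\<Sum>l<k - 1. of_int (z i) ^ l * b l)) =
     (\<Sum>i\<le>k - 1. - ((-1) ^ i * real ((k - 1) choose i) * (\<Sum>l<k - 1. (of_int n + of_nat i * of_int d) ^ l * b l)))"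
    by (rule sum.reindex_bij_witness[of _ "\<lambda>i. i + 1" "\<lambda>i. i - 1"])
      (use assms(1) in \<open>auto simp: z of_nat_diff power_eq_if\<close>)
  also have "\<dots> = - (\<Sum>l<k - 1. b l * (\<Sum>i\<le>k - 1. (-1) ^ i * real ((k - 1) choose i) * (of_int n + of_nat i * of_int d) ^ l))"
    unfolding sum_distrib_left sum_negf by (subst sum.swap) (simp add: ac_simps)
  also have "\<dots> = 0" by (simp add: alternating_binomial_sum_power)
  finally show ?thesis .
qed

text \<open>The image satisfies the equation of the \<open>y\<close>-coordinates because polynomial
  part and shifts cancel separately. Conversely, the rotation is found by dividing by
  \<open>d\<close>, interpolation prescribes the first \<open>k - 1\<close> of the
  \<open>y\<close>-coordinates, and the equation forces the last one.\<close>

theorem range_AP_matrix: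
  fixes n d :: int
  assumes k: "k \<ge> 2" "even k" and d: "d \<noteq> 0"
    and z: "\<And>i. z i = n + (int i - 1) * d"
    and \<sigma>: "\<And>i. i \<in> {1..k} \<Longrightarrow> \<sigma> i < M" "\<And>i. i \<in> {1..k} \<Longrightarrow> \<sigma> (k + 1 - i) = \<sigma> i"
  shows "range (torus_hom (k + 1 + M) (2 * k) (AP_matrix k z \<sigma>)) = V k"
proof (intro equalityI subsetI)
  let ?\<phi> = "torus_hom (k + 1 + M) (2 * k) (AP_matrix k z \<sigma>)"
  let ?c = "\<lambda>i. (-1) ^ i * real ((k - 1) choose (i - 1))"
  have k1: "k \<ge> 1" using k by simp
  have hom: "?\<phi> w i = frac (x_val w (z i))" "?\<phi> w (k + i) = frac (y_val k w (z i) (\<sigma> i))"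
    if "i \<in> {1..k}" for w i
    using torus_hom_AP_matrix[of k \<sigma> M i z w] k1 \<sigma>(1) that by auto
  have cZ: "?c i * x \<in> \<int>" if "x \<in> \<int>" for i x using that by (intro Ints_mult) auto
  have ysum: "(\<Sum>i=1..k. ?c i * y_val k w (z i) (\<sigma> i)) = 0" for w
  proof -
    have "(\<Sum>i=1..k. ?c i * y_val k w (z i) (\<sigma> i)) =
        (\<Sum>i=1..k. ?c i * (\<Sum>l<k - 1. of_int (z i) ^ l * w (3 + l))) + (\<Sum>i=1..k. ?c i * w (k + 2 + \<sigma> i))"
      by (simp add: y_val_def algebra_simps sum.distrib)
    also have "\<dots> = 0"
      using binomial_weights_poly[OF k1 z, of "\<lambda>l. w (3 + l)"]
        binomial_weights_antisym[OF k(2), of "\<lambda>i. w (k + 2 + \<sigma> i)"] \<sigma>(2) by simp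
    finally show ?thesis .
  qed
  {
    fix v assume "v \<in> range ?\<phi>"
    then obtain w where v: "v = ?\<phi> w" by auto
    have "v \<in> torus (2 * k)" by (auto simp: v torus_hom_def torus_def frac_lt_1)
    moreover have "(v (i + 1) - v i) - (v 2 - v 1) \<in> \<int>" if i: "i \<in> {1..<k}" for i
    proof -
      have "v i = frac (x_val w (z i))" "v (i + 1) = frac (x_val w (z (i + 1)))"
        "v 2 = frac (x_val w (z 2))" "v 1 = frac (x_val w (z 1))"
        unfolding v by (rule hom, use i k in auto)+
      then have "(v (i + 1) - v i) - (v 2 - v 1) = of_int (
         - \<lfloor>x_val w (z (i + 1))\<rfloor> + \<lfloor>x_val w (z i)\<rfloor> + \<lfloor>x_val w (z 2)\<rfloor> - \<lfloor>x_val w (z 1)\<rfloor>)"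
        by (simp add: frac_def x_val_def z algebra_simps)
      then show ?thesis by (simp only: Ints_of_int)
    qed
    moreover have "(\<Sum>i=1..k. ?c i * v (k + i)) \<in> \<int>"
    proof -
      have "(\<Sum>i=1..k. ?c i * v (k + i)) =
          (\<Sum>i=1..k. ?c i * (frac (y_val k w (z i) (\<sigma> i)) - y_val k w (z i) (\<sigma> i)))
          + (\<Sum>i=1..k. ?c i * y_val k w (z i) (\<sigma> i))"
        unfolding sum.distrib[symmetric]
      proof (rule sum.cong[OF refl])
        fix i assume i: "i \<in> {1..k}"
        have "v (k + i) = frac (y_val k w (z i) (\<sigma> i))" unfolding v by (rule hom(2)[OF i])
        then show "?c i * v (k + i) = ?c i * (frac (y_val k w (z i) (\<sigma> i)) - y_val k w (z i) (\<sigma> i)) + ?c i * y_val k w (z i) (\<sigma> i)"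
          by (simp only: right_diff_distrib diff_add_cancel)
      qed
      also have "\<dots> \<in> \<int>"
        unfolding ysum by (intro Ints_add Ints_sum cZ frac_diff_Ints) simp
      finally show ?thesis .
    qed
    ultimately show "v \<in> V k" by (simp add: V_def)
  }
  {
    fix v assume v: "v \<in> V k"
    have inj: "inj_on (\<lambda>i. of_int (z (i + 1)) :: real) {..<k - 1}"
      using d by (auto simp: inj_on_def z)
    from interpolation_exists[OF inj, of "\<lambda>i. v (k + (i + 1))"]
    obtain b where b: "\<And>i. i < k - 1 \<Longrightarrow> (\<Sum>l<k - 1. of_int (z (i + 1)) ^ l * b l) = v (k + (i + 1))" by blast
    \<comment> \<open>The slope solves \<open>d * w 2 = v 2 - v 1\<close> in the reals, and the base
      point puts the first point of the progression at \<open>v 1\<close>. All shifts are 0, so the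
      value of \<sigma> does not matter here.\<close>
    define w where "w j = (if j = 1 then v 1 - of_int n * ((v 2 - v 1) / of_int d)
       else if j = 2 then (v 2 - v 1) / of_int d else if j \<le> k + 1 then b (j - 3) else 0)" for j
    have x: "x_val w (z i) = v 1 + (real i - 1) * (v 2 - v 1)" for i
      using d by (simp add: x_val_def w_def z field_simps)
    have y: "y_val k w (z i) c = (\<Sum>l<k - 1. of_int (z i) ^ l * b l)" for i c
    proof -
      have "(\<Sum>l<k - 1. of_int (z i) ^ l * w (3 + l)) = (\<Sum>l<k - 1. of_int (z i) ^ l * b l)"
        by (rule sum.cong) (auto simp: w_def)
      then show ?thesis using k by (simp add: y_val_def w_def)
    qed
    have vx: "x_val w (z i) - v i \<in> \<int>" if "i \<in> {1..k}" for i
    proof -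
      from that have "1 \<le> i" "i \<le> k" by auto
      then show ?thesis
      proof (induction i rule: dec_induct)
        case (step i)
        then have "(v (i + 1) - v i) - (v 2 - v 1) \<in> \<int>" using v by (simp add: V_def)
        with step have "(x_val w (z i) - v i) - ((v (i + 1) - v i) - (v 2 - v 1)) \<in> \<int>"
          using Ints_diff[of "x_val w (z i) - v i" "(v (i + 1) - v i) - (v 2 - v 1)"] by simp
        also have "(x_val w (z i) - v i) - ((v (i + 1) - v i) - (v 2 - v 1)) = x_val w (z (Suc i)) - v (Suc i)"
          unfolding Suc_eq_plus1 by (simp only: x of_nat_add of_nat_1) (simp add: algebra_simps)
        finally show ?case .
      qed (simp add: x)
    qed
    have vy0: "y_val k w (z i) (\<sigma> i) = v (k + i)" if "i \<in> {1..k - 1}" for i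
      using b[of "i - 1"] that k by (auto simp: y)
    have vy: "y_val k w (z i) (\<sigma> i) - v (k + i) \<in> \<int>" if i: "i \<in> {1..k}" for i
    proof (cases "i = k")
      case False
      with vy0[of i] i show ?thesis by auto
    next
      case True
      have split: "(\<Sum>i=1..k. g i) = (\<Sum>i=1..k - 1. g i) + g k" for g :: "nat \<Rightarrow> real"
      proof -
        have "{1..k} = insert k {1..k - 1}" using k by auto
        then show ?thesis using k by simp
      qed
      have "(\<Sum>i=1..k. ?c i * v (k + i)) = (\<Sum>i=1..k. ?c i * v (k + i)) - (\<Sum>i=1..k. ?c i * y_val k w (z i) (\<sigma> i))"
        by (simp only: ysum diff_zero)
      also have "\<dots> = (\<Sum>i=1..k. ?c i * (v (k + i) - y_val k w (z i) (\<sigma> i)))"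
        by (simp add: sum_subtractf algebra_simps)
      \<comment> \<open>All earlier differences vanish exactly. The last coefficient is
        \<open>(-1) ^ k\<close>, which is 1 for even \<open>k\<close>, so integrality of the sum is
        integrality of the last difference.\<close>
      also have "\<dots> = ?c k * (v (k + k) - y_val k w (z k) (\<sigma> k))"
        unfolding split by (subst sum.neutral) (auto simp: vy0)
      also have "\<dots> = v (k + k) - y_val k w (z k) (\<sigma> k)" using k by simp
      finally have "v (k + k) - y_val k w (z k) (\<sigma> k) \<in> \<int>" using v by (simp add: V_def)
      then show ?thesis using True Ints_minus by fastforce
    qed
    have "?\<phi> w = v"
    proof
      fix j
      have fv: "frac (v j) = v j" if "j \<in> {1..2 * k}" for j
        using v that by (auto simp: V_def torus_def PiE_iff frac_eq)
      consider "j \<in> {1..k}" | i where "j = k + i" "i \<in> {1..k}" | "j \<notin> {1..2 * k}"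
      proof (cases "j \<in> {1..2 * k} \<and> j > k")
        case True
        then show ?thesis by (intro that(2)[of "j - k"]) auto
      qed (use that in fastforce)
      then show "?\<phi> w j = v j"
      proof cases
        case 1
        then show ?thesis using vx[OF 1] fv[of j] by (simp add: hom frac_eq_frac_iff[symmetric])
      next
        case 2
        then show ?thesis using vy[OF 2(2)] fv[of j] by (simp add: hom frac_eq_frac_iff[symmetric])
      next
        case 3
        then show ?thesis using v by (auto simp: torus_hom_def V_def torus_def)
      qed
    qed
    then show "v \<in> range ?\<phi>" by (metis rangeI)
  }
qed


section \<open>Borel representatives of admissible functions\<close>

text \<open>The given matrix and the identity matrix both map onto the full torus, so both
  push-forwards are its Haar measure. The homomorphism of the identity matrix fixes only
  representatives, which are almost all points of the cube.\<close>

lemma cube_integral_torus_hom: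
  assumes r: "range (torus_hom K m a) = torus m" and f: "f \<in> borel_measurable (PiM {1..m} (\<lambda>_. borel))"
  shows "(\<integral>\<^sup>+ w. f (torus_hom K m a w) \<partial>cube K) = (\<integral>\<^sup>+ v. f v \<partial>cube m)"
proof -
  let ?I = "\<lambda>j i :: nat. if i = j then 1 else 0 :: int"
  have idI: "torus_hom m m ?I v = v" if "v \<in> torus m" for v
  proof
    fix j
    have "(\<Sum>i=1..m. of_int (?I j i) * v i) = v j" if "j \<in> {1..m}"
    proof -
      have "(\<Sum>i=1..m. of_int (?I j i) * v i) = (\<Sum>i=1..m. if i = j then v i else 0)"
        by (rule sum.cong) auto
      then show ?thesis using that by simp
    qed
    moreover have "frac (v j) = v j" if "j \<in> {1..m}"
      using \<open>v \<in> torus m\<close> that by (simp add: torus_def PiE_iff frac_eq)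
    moreover have "v j = undefined" if "j \<notin> {1..m}"
      using \<open>v \<in> torus m\<close> that unfolding torus_def by (rule PiE_arb)
    ultimately show "torus_hom m m ?I v j = v j"
      unfolding torus_hom_def by (cases "j \<in> {1..m}") (simp_all only: restrict_apply if_True if_False simp_thms)
  qed
  have rI: "range (torus_hom m m ?I) = torus m"
  proof (intro equalityI subsetI)
    fix v assume "v \<in> torus m"
    then show "v \<in> range (torus_hom m m ?I)" using idI[of v] by (intro range_eqI[of _ _ v]) simp
  next
    fix v assume "v \<in> range (torus_hom m m ?I)"
    then obtain w where "v = torus_hom m m ?I w" by blast
    then show "v \<in> torus m" by (simp add: torus_hom_def torus_def frac_lt_1)
  qed
  have hom: "(\<integral>\<^sup>+ w. f (torus_hom L m b w) \<partial>cube L) = (\<integral>\<^sup>+ v. f v \<partial>haar_measure m (torus m))"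
    if b: "range (torus_hom L m b) = torus m" for L b
  proof -
    have "torus_hom L m b \<in> measurable (cube L) (sub_borel m (torus m))"
      using b by (intro measurable_restrict_space2 measurable_torus_hom) auto
    moreover have "f \<in> borel_measurable (sub_borel m (torus m))"
      by (rule measurable_restrict_space1) (rule f)
    ultimately show ?thesis
      unfolding haar_measure_torus_hom[OF b] by (intro nn_integral_distr[symmetric]) simp_all
  qed
  have ae: "AE v in cube m. v \<in> torus m"
  proof -
    have "AE v in cube m. \<forall>i\<in>{1..m}. v i \<in> {0..<1}"
      unfolding cube_def
    proof (rule AE_finite_allI)
      fix i assume "i \<in> {1..m}"
      then show "AE v in PiM {1..m} (\<lambda>_. circle). v i \<in> {0..<1}"
        by (rule AE_PiM_component[OF circle.prob_space_axioms _ AE_circle])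
    qed simp
    moreover have "AE v in cube m. v \<in> extensional {1..m}"
      by (rule AE_I2) (simp add: space_cube)
    ultimately show ?thesis by eventually_elim (simp add: torus_def PiE_iff)
  qed
  have "(\<integral>\<^sup>+ w. f (torus_hom K m a w) \<partial>cube K) = (\<integral>\<^sup>+ v. f (torus_hom m m ?I v) \<partial>cube m)"
    by (simp only: hom[OF r] hom[OF rI])
  also have "\<dots> = (\<integral>\<^sup>+ v. f v \<partial>cube m)"
    by (rule nn_integral_cong_AE) (use ae in eventually_elim, simp only: idI)
  finally show ?thesis .
qed

section \<open>Passing from a Riemann integrable function to a Borel one\<close>

lemma riemann_integrable_imp_integrable_on:
  assumes "riemann_integrable_cbox f a b"
  shows "f integrable_on cbox a b"
proof -
  from assms obtain I where I: "\<And>e. e > 0 \<Longrightarrow> \<exists>\<delta>>0. \<forall>D. D tagged_division_of cbox a b \<and> (\<lambda>x. ball x \<delta>) fine D \<longrightarrow>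
        \<bar>(\<Sum>(x,K)\<in>D. measure lborel K * f x) - I\<bar> < e"
    unfolding riemann_integrable_cbox_def by blast
  have "(f has_integral I) (cbox a b)"
    unfolding has_integral
  proof (intro allI impI)
    fix e :: real assume "e > 0"
    from I[OF this] obtain \<delta> where "\<delta> > 0" "\<forall>D. D tagged_division_of cbox a b \<and> (\<lambda>x. ball x \<delta>) fine D \<longrightarrow>
        \<bar>(\<Sum>(x,K)\<in>D. measure lborel K * f x) - I\<bar> < e" by blast
    then show "\<exists>\<gamma>. gauge \<gamma> \<and> (\<forall>\<D>. \<D> tagged_division_of cbox a b \<and> \<gamma> fine \<D> \<longrightarrow>
        norm ((\<Sum>(x, k)\<in>\<D>. measure lborel k *\<^sub>R f x) - I) < e)"
      by (intro exI[of _ "\<lambda>x. ball x \<delta>"]) (auto intro: gauge_ball)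
  qed
  then show ?thesis by blast
qed

lemma riemann_integrable_const: "riemann_integrable_cbox (\<lambda>_. c) a b"
  unfolding riemann_integrable_cbox_def
proof (rule exI[of _ "measure lborel (cbox a b) * c"], intro allI impI)
  fix e :: real assume "e > 0"
  have "(\<Sum>(x,K)\<in>D. measure lborel K * c) = measure lborel (cbox a b) * c" if "D tagged_division_of cbox a b" for D
    using additive_content_tagged_division[OF that]
    by (simp add: split_beta sum_distrib_right[symmetric])
  then show "\<exists>\<delta>>0. \<forall>D. D tagged_division_of cbox a b \<and> (\<lambda>x. ball x \<delta>) fine D \<longrightarrow>
        \<bar>(\<Sum>(x,K)\<in>D. measure lborel K * c) - measure lborel (cbox a b) * c\<bar> < e"
    using \<open>e > 0\<close> by (intro exI[of _ 1]) auto
qed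

text \<open>Makes the infimum in \<open>rho\<close> range over a nonempty set, so that a bound on it
  yields an actual function \<open>F\<close>.\<close>

lemma admissible_const:
  assumes "0 \<le> \<alpha>" "\<alpha> \<le> 1"
  shows "admissible \<alpha> (\<lambda>_. \<alpha>)"
proof -
  have "((\<lambda>y::real. \<alpha>) has_integral \<alpha>) {0..1}"
    using has_integral_const_real[of \<alpha> 0 1] by simp
  then show ?thesis using assms by (simp add: admissible_def riemann_integrable_const)
qed

text \<open>Composition with \<open>torus_hom\<close> preserves Borel measurability, so the
  probabilistic argument is run on \<open>H\<close> instead of \<open>F\<close>. Clamping makes the
  bounds hold everywhere rather than almost everywhere.\<close>

lemma admissible_ex_borel:
  assumes "admissible \<alpha> F"
  obtains H where "H \<in> borel_measurable borel" "\<And>p. 0 \<le> H p" "\<And>p. H p \<le> 1"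
    "AE p in lborel. p \<in> {0..<1} \<times> {0..<1} \<longrightarrow> F p = H p"
proof -
  let ?C = "cbox (0, 0) (1, 1) :: (real \<times> real) set"
  have F: "0 \<le> F p" "F p \<le> 1" for p using assms unfolding admissible_def by blast+
  have "F integrable_on ?C"
    using assms by (intro riemann_integrable_imp_integrable_on) (simp add: admissible_def)
  then have "F absolutely_integrable_on ?C"
    by (intro nonnegative_absolutely_integrable_1) (use F in auto)
  then have "(\<lambda>x. indicator ?C x *\<^sub>R F x) \<in> borel_measurable (completion lborel)"
    unfolding set_integrable_def by (rule borel_measurable_integrable)
  from completion_ex_borel_measurable_real[OF this] obtain g where
    g: "g \<in> borel_measurable lborel" "AE x in lborel. indicator ?C x *\<^sub>R F x = g x" by auto
  show ?thesis
  proof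
    show "(\<lambda>p. max 0 (min 1 (g p))) \<in> borel_measurable borel" using g(1) by simp
    show "AE p in lborel. p \<in> {0..<1} \<times> {0..<1} \<longrightarrow> F p = max 0 (min 1 (g p))"
      using g(2)
    proof eventually_elim
      case (elim p)
      show ?case
      proof
        assume "p \<in> {0..<1} \<times> {0..<1}"
        then have "p \<in> ?C" by (auto simp: cbox_Pair_eq)
        then have "g p = F p" using elim by simp
        then show "F p = max 0 (min 1 (g p))" using F[of p] by simp
      qed
    qed
  qed auto
qed

lemma AE_circle_iff: "(AE x in circle. P x) \<longleftrightarrow> (AE x in lborel. x \<in> {0..<1} \<longrightarrow> P x)"
proof -
  have "0 < (indicator {0..<1} x :: ennreal) \<longleftrightarrow> x \<in> {0..<1}" for x :: real
    by (simp add: indicator_def)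
  then show ?thesis unfolding circle_def by (subst AE_density) simp_all
qed

lemma integral_circle: "f \<in> borel_measurable borel \<Longrightarrow> (\<integral>x. f x \<partial>circle) = (\<integral>x. indicator {0..<1} x * f x \<partial>lborel)"
  for f :: "real \<Rightarrow> real"
proof -
  assume f: "f \<in> borel_measurable borel"
  have "circle = density lborel (\<lambda>x. ennreal (indicator {0..<1} x))"
    unfolding circle_def by (rule arg_cong[where f = "density lborel"]) (auto simp: indicator_def)
  then show ?thesis using f integral_density[of f lborel "\<lambda>x. indicator {0..<1} x"] by simp
qed

text \<open>By Fubini almost every vertical slice of \<open>F\<close> agrees almost everywhere with
  that of \<open>H\<close>; what remains is to compare the gauge integral with the Lebesgue
  integral.\<close>

lemma borel_marginal:
  assumes F: "admissible \<alpha> F"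
    and H: "H \<in> borel_measurable borel" "\<And>p. 0 \<le> H p" "\<And>p. H p \<le> 1"
    "AE p in lborel. p \<in> {0..<1} \<times> {0..<1} \<longrightarrow> F p = H p"
  shows "AE x in circle. (\<integral>y. H (x, y) \<partial>circle) = \<alpha>"
proof -
  have "AE x in lborel. AE y in lborel. (x, y) \<in> {0..<1} \<times> {0..<1} \<longrightarrow> F (x, y) = H (x, y)"
    using H(4) unfolding lborel_prod[symmetric] by (rule lborel_pair.AE_pair)
  moreover have "AE x in lborel. x \<in> {0..<1} \<longrightarrow> ((\<lambda>y. F (x, y)) has_integral \<alpha>) {0..1}"
    using F by (simp add: admissible_def AE_restrict_space_iff AE_completion_iff)
  ultimately show ?thesis
    unfolding AE_circle_iff
  proof eventually_elim
    case (elim x)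
    show ?case
    proof
      assume x: "x \<in> {0..<1}"
      have Hm: "(\<lambda>y. H (x, y)) \<in> borel_measurable borel"
        by (rule measurable_compose[OF _ H(1)]) simp
      let ?f = "\<lambda>y. indicator {0..<1} y * H (x, y)"
      have "integrable lborel ?f"
      proof (rule Bochner_Integration.integrable_bound[of _ "\<lambda>y. indicator {0..<1} y :: real"])
        show "AE y in lborel. norm (?f y) \<le> norm (indicator {0..<1} y :: real)"
          using H(2,3) by (auto simp: indicator_def)
      qed (use Hm in auto)
      then have 1: "(?f has_integral integral\<^sup>L lborel ?f) UNIV" by (rule has_integral_integral_lborel)
      from elim(1) obtain N where
        N2: "\<And>y. y \<in> space lborel - N \<Longrightarrow> (x, y) \<in> {0..<1} \<times> {0..<1} \<longrightarrow> F (x, y) = H (x, y)"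
        and N: "N \<in> null_sets lborel"
        by (rule AE_E3) blast
      have FH: "F (x, y) = H (x, y)" if "y \<in> {0..<1}" "y \<notin> N" for y using N2[of y] x that by simp
      have "negligible N" using N by (simp add: negligible_iff_null_sets null_sets_completionI)
      \<comment> \<open>The point \<open>1\<close> belongs to the interval of the gauge integral but
        not to \<open>{0..<1}\<close>; adding it to the null set reconciles the two.\<close>
      then have neg: "negligible (insert 1 N)" by simp
      have "((\<lambda>y. if y \<in> {0..1} then F (x, y) else 0) has_integral \<alpha>) UNIV"
        using elim(2) x by (simp only: has_integral_restrict_UNIV)
      then have "(?f has_integral \<alpha>) UNIV"
      proof (rule has_integral_spike[OF neg, rotated])
        fix y assume "y \<in> UNIV - insert 1 N"
        then show "?f y = (if y \<in> {0..1} then F (x, y) else 0)" using FH[of y] by (auto simp: indicator_def)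
      qed
      with 1 have "integral\<^sup>L lborel ?f = \<alpha>" by (rule has_integral_unique)
      then show "(\<integral>y. H (x, y) \<partial>circle) = \<alpha>" using Hm by (simp add: integral_circle)
    qed
  qed
qed

text \<open>Puts the exceptional set into the form needed later: a Borel set whose indicator
  integrates to 0 over \<open>cube 2\<close>, which can be pulled back along a homomorphism onto the
  two-dimensional torus.\<close>

lemma AE_cube_2:
  assumes "AE p in lborel. p \<in> {0..<1} \<times> {0..<1} \<longrightarrow> P p"
  obtains N :: "(real \<times> real) set" where "N \<in> sets borel" "(\<integral>\<^sup>+ v. indicator N (v 1, v 2) \<partial>cube 2) = 0"
    "\<And>p. p \<in> {0..<1} \<times> {0..<1} \<Longrightarrow> p \<notin> N \<Longrightarrow> P p"
proof -
  from assms obtain N where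
    N2: "\<And>p. p \<in> space lborel - N \<Longrightarrow> p \<in> {0..<1} \<times> {0..<1} \<longrightarrow> P p"
    and N: "N \<in> null_sets lborel"
    by (rule AE_E3) blast
  have [measurable]: "N \<in> sets borel" using N by (simp add: null_sets_def)
  have "AE p in lborel. p \<notin> N" by (rule AE_not_in) fact
  then have "AE x in lborel. AE y in lborel. (x, y) \<notin> N"
    unfolding lborel_prod[symmetric] by (rule lborel_pair.AE_pair)
  then have ae: "AE x in circle. AE y in circle. (x, y) \<notin> N"
    unfolding AE_circle_iff by (auto elim: eventually_mono)
  have Nb: "N \<in> sets (borel \<Otimes>\<^sub>M borel)" unfolding borel_prod by fact
  have m: "(\<lambda>(x, y). indicator N (x, y) :: ennreal) \<in> borel_measurable (circle \<Otimes>\<^sub>M circle)"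
    using Nb by (simp cong: measurable_cong_sets sets_pair_measure_cong)
  have e: "{1..2} = {1, 2 :: nat}" by auto
  have "(\<integral>\<^sup>+ v. indicator N (v 1, v 2) \<partial>cube 2) = (\<integral>\<^sup>+ z. indicator N (fst z, snd z) \<partial>(circle \<Otimes>\<^sub>M circle))"
    unfolding cube_def e by (rule circles.product_nn_integral_pair[OF m]) simp
  also have "\<dots> = (\<integral>\<^sup>+ x. (\<integral>\<^sup>+ y. indicator N (x, y) \<partial>circle) \<partial>circle)"
    using m by (subst circle.nn_integral_fst[symmetric]) (simp_all add: split_beta)
  also have "\<dots> = (\<integral>\<^sup>+ x. 0 \<partial>circle)"
  proof (rule nn_integral_cong_AE, use ae in eventually_elim)
    fix x assume "AE y in circle. (x, y) \<notin> N"
    then have "(\<integral>\<^sup>+ y. indicator N (x, y) \<partial>circle) = (\<integral>\<^sup>+ y. 0 \<partial>circle)"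
      by (intro nn_integral_cong_AE) (auto elim: eventually_mono)
    then show "(\<integral>\<^sup>+ y. indicator N (x, y) \<partial>circle) = 0" by simp
  qed
  finally show ?thesis using N2 by (intro that[of N]) simp_all
qed

text \<open>Guarantees that the integrand of \<open>Lambda\<close>, formed with \<open>F\<close>
  itself, is measurable for the completed Haar measure.\<close>

lemma borel_measurable_completion_AE:
  assumes g: "g \<in> borel_measurable M" and ae: "AE x in M. f x = g x"
  shows "f \<in> borel_measurable (completion M)"
proof (rule measurableI)
  fix A :: "'b set" assume A: "A \<in> sets borel"
  interpret completion: complete_measure "completion M" by standard
  show "f -` A \<inter> space (completion M) \<in> sets (completion M)"
  proof (rule completion.in_sets_AE)
    show "g -` A \<inter> space M \<in> sets (completion M)" using g A by (auto intro: measurable_sets)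
    have "AE x in M. (x \<in> g -` A \<inter> space M) = (x \<in> f -` A \<inter> space (completion M))"
      using ae by eventually_elim simp
    then show "AE x in completion M. (x \<in> g -` A \<inter> space M) = (x \<in> f -` A \<inter> space (completion M))"
      by (rule AE_completion)
  qed auto
qed auto


section \<open>From weights to colourings\<close>

text \<open>The method of conditional expectations: an affine function on the unit interval is at
  some end point at most its value at a given point, so coordinates are rounded one at a time
  without increasing \<open>G\<close>.\<close>

lemma multiaffine_rounding:
  fixes G :: "('a \<Rightarrow> real) \<Rightarrow> real"
  assumes "finite J" and f: "\<And>j. j \<in> J \<Longrightarrow> 0 \<le> f j \<and> f j \<le> 1"
    and aff: "\<And>f j v. j \<in> J \<Longrightarrow> G (f(j := v)) = (1 - v) * G (f(j := 0)) + v * G (f(j := 1))"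
  shows "\<exists>g. (\<forall>j\<in>J. g j \<in> {0, 1}) \<and> (\<forall>j. j \<notin> J \<longrightarrow> g j = f j) \<and> G g \<le> G f"
  using assms
proof (induction J arbitrary: f)
  case (insert a J)
  have "G f = (1 - f a) * G (f(a := 0)) + f a * G (f(a := 1))"
    using insert.prems(2)[OF insertI1, of f "f a"] by (simp only: fun_upd_triv)
  have "0 \<le> f a" "f a \<le> 1" using insert.prems(1)[of a] by auto
  have "G (f(a := 0)) \<le> G f \<or> G (f(a := 1)) \<le> G f"
  proof (rule disjCI, rule ccontr)
    assume "\<not> G (f(a := 1)) \<le> G f" "\<not> G (f(a := 0)) \<le> G f"
    then have "- G (f(a := 0)) < - G f" "- G (f(a := 1)) < - G f" by auto
    then have "(1 - f a) * - G (f(a := 0)) + f a * - G (f(a := 1)) < - G f"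
      using \<open>0 \<le> f a\<close> \<open>f a \<le> 1\<close> by (intro convex_bound_lt) simp_all
    then show False
      using \<open>G f = (1 - f a) * G (f(a := 0)) + f a * G (f(a := 1))\<close> by linarith
  qed
  then obtain e where e: "e \<in> {0, 1}" "G (f(a := e)) \<le> G f" by blast
  have "\<exists>g. (\<forall>j\<in>J. g j \<in> {0, 1}) \<and> (\<forall>j. j \<notin> J \<longrightarrow> g j = (f(a := e)) j) \<and> G g \<le> G (f(a := e))"
  proof (rule insert.IH)
    show "0 \<le> (f(a := e)) j \<and> (f(a := e)) j \<le> 1" if "j \<in> J" for j
      using insert.prems(1)[of j] that e(1) by auto
  qed (rule insert.prems(2), rule insertI2)
  then obtain g where g: "\<forall>j\<in>J. g j \<in> {0, 1}" "\<forall>j. j \<notin> J \<longrightarrow> g j = (f(a := e)) j" "G g \<le> G (f(a := e))"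
    by blast
  have "g a = e" using g(2) insert.hyps by simp
  then show ?case using g e by (intro exI[of _ g]) auto
qed auto

text \<open>Injectivity of \<open>z\<close> means that the changed coordinate \<open>j\<close>
  enters at most one factor.\<close>

lemma multiaffine_prod:
  fixes h :: "'i \<Rightarrow> real \<Rightarrow> real"
  assumes "finite I" "inj_on z I" and h: "\<And>i v. i \<in> I \<Longrightarrow> h i v = (1 - v) * h i 0 + v * h i 1"
  shows "(\<Prod>i\<in>I. h i ((f(j := v)) (z i))) =
    (1 - v) * (\<Prod>i\<in>I. h i ((f(j := 0)) (z i))) + v * (\<Prod>i\<in>I. h i ((f(j := 1)) (z i)))"
proof (cases "j \<in> z ` I")
  case False
  then have "(\<Prod>i\<in>I. h i ((f(j := u)) (z i))) = (\<Prod>i\<in>I. h i (f (z i)))" for u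
    by (intro prod.cong) auto
  then show ?thesis by (simp add: algebra_simps)
next
  case True
  then obtain i where i: "i \<in> I" "z i = j" by auto
  have *: "(\<Prod>i\<in>I. h i ((f(j := u)) (z i))) = h i u * (\<Prod>i\<in>I - {i}. h i (f (z i)))" for u
  proof -
    have "(\<Prod>i'\<in>I - {i}. h i' ((f(j := u)) (z i'))) = (\<Prod>i\<in>I - {i}. h i (f (z i)))"
      using i assms(2) by (intro prod.cong) (auto simp: inj_on_def)
    then show ?thesis using assms(1) i by (subst prod.remove[of I i]) simp_all
  qed
  show ?thesis unfolding * by (subst h[OF i(1), of v]) (simp only: algebra_simps)
qed

definition AP_point :: "int \<times> int \<Rightarrow> nat \<Rightarrow> int" where
  "AP_point nd i = fst nd + (int i - 1) * snd nd"

definition sym_AP :: "nat \<Rightarrow> (int \<Rightarrow> nat) \<Rightarrow> int \<times> int \<Rightarrow> bool" where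
  "sym_AP k c nd \<longleftrightarrow> (\<forall>i\<in>{1..k}. c (AP_point nd i) = c (AP_point nd (k + 1 - i)))"

text \<open>The representative in the first half of the pair of \<open>i\<close> and
  \<open>k + 1 - i\<close>; composing with it extends a colour pattern on the first half to a
  symmetric one.\<close>

definition fold_index :: "nat \<Rightarrow> nat \<Rightarrow> nat" where
  "fold_index k i = (if i \<le> k div 2 then i else k + 1 - i)"

text \<open>
  For 0/1 weights this dominates the indicator of a symmetrically coloured progression; as the points
  of a progression are distinct, it is affine in each weight, so that weights can be rounded.
\<close>

definition bad_weight :: "nat \<Rightarrow> nat \<Rightarrow> (int \<times> nat \<Rightarrow> real) \<Rightarrow> int \<times> int \<Rightarrow> real" where
  "bad_weight k M f nd =
     (\<Sum>i\<in>{1..k}. \<Prod>c<M. 1 - f (AP_point nd i, c)) +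
     (\<Sum>\<sigma>\<in>{1..k div 2} \<rightarrow>\<^sub>E {..<M}. \<Prod>i\<in>{1..k}. f (AP_point nd i, \<sigma> (fold_index k i)))"

lemma inj_AP_point: "snd nd \<noteq> 0 \<Longrightarrow> inj (AP_point nd)"
  by (auto simp: inj_on_def AP_point_def)

lemma bad_weight_multiaffine:
  assumes "snd nd \<noteq> 0"
  shows "bad_weight k M (f(j := v)) nd = (1 - v) * bad_weight k M (f(j := 0)) nd + v * bad_weight k M (f(j := 1)) nd"
proof -
  have 1: "(\<Prod>c<M. 1 - (f(j := v)) (x, c)) =
      (1 - v) * (\<Prod>c<M. 1 - (f(j := 0)) (x, c)) + v * (\<Prod>c<M. 1 - (f(j := 1)) (x, c))" for x
    by (rule multiaffine_prod[where h = "\<lambda>_ u. 1 - u" and z = "\<lambda>c. (x, c)"]) (auto simp: inj_on_def)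
  have 2: "(\<Prod>i\<in>{1..k}. (f(j := v)) (AP_point nd i, s i)) =
      (1 - v) * (\<Prod>i\<in>{1..k}. (f(j := 0)) (AP_point nd i, s i)) + v * (\<Prod>i\<in>{1..k}. (f(j := 1)) (AP_point nd i, s i))" for s
    using inj_AP_point[OF assms]
    by (intro multiaffine_prod[where h = "\<lambda>_ u. u" and z = "\<lambda>i. (AP_point nd i, s i)"]) (auto simp: inj_on_def)
  show ?thesis
    unfolding bad_weight_def 1 2 sum.distrib by (simp add: sum_distrib_left algebra_simps)
qed

text \<open>The colour \<open>M\<close> marks the uncovered points.\<close>

definition first_color :: "nat \<Rightarrow> (int \<times> nat \<Rightarrow> real) \<Rightarrow> int \<Rightarrow> nat" where
  "first_color M g x = (if \<exists>c<M. g (x, c) = 1 then LEAST c. g (x, c) = 1 else M)"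

lemma first_color_le: "first_color M g x \<le> M"
proof (cases "\<exists>c<M. g (x, c) = 1")
  case True
  then obtain c where "c < M" "g (x, c) = 1" by blast
  then have "(LEAST c. g (x, c) = 1) \<le> c" by (intro Least_le)
  then show ?thesis using \<open>c < M\<close> by (simp add: first_color_def)
qed (auto simp: first_color_def)

lemma first_color_eq_1: "first_color M g x < M \<Longrightarrow> g (x, first_color M g x) = 1"
  unfolding first_color_def by (auto split: if_splits intro: LeastI)

text \<open>In a symmetric progression either some point is uncovered, and its product in the first
  sum is 1, or the colours form a pattern whose product in the second sum is 1. All other terms are
  nonnegative.\<close>

lemma sym_AP_bad_weight:
  assumes "even k" and g: "\<And>i c. i \<in> {1..k} \<Longrightarrow> c < M \<Longrightarrow> g (AP_point nd i, c) \<in> {0, 1}"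
  shows "of_bool (sym_AP k (first_color M g) nd) \<le> bad_weight k M g nd"
proof -
  let ?c = "\<lambda>i. first_color M g (AP_point nd i)"
  have g01: "0 \<le> g (AP_point nd i, c)" "g (AP_point nd i, c) \<le> 1" if "i \<in> {1..k}" "c < M" for i c
    using g[OF that] by auto
  have fi: "fold_index k i \<in> {1..k div 2}" if "i \<in> {1..k}" for i
    using that \<open>even k\<close> by (auto simp: fold_index_def elim!: evenE)
  have nn1: "0 \<le> (\<Prod>c<M. 1 - g (AP_point nd i, c))" if "i \<in> {1..k}" for i
    by (intro prod_nonneg) (use g01 that in auto)
  have nn2: "0 \<le> (\<Prod>i\<in>{1..k}. g (AP_point nd i, \<sigma> (fold_index k i)))" if "\<sigma> \<in> {1..k div 2} \<rightarrow>\<^sub>E {..<M}" for \<sigma>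
  proof (intro prod_nonneg g01 ballI)
    fix i assume "i \<in> {1..k}"
    from PiE_mem[OF that fi[OF this]] show "\<sigma> (fold_index k i) < M" by simp
  qed
  show ?thesis
  proof (cases "sym_AP k (first_color M g) nd")
    case False
    then show ?thesis unfolding bad_weight_def by (auto intro!: add_nonneg_nonneg sum_nonneg nn1 nn2)
  next
    case sym: True
    show ?thesis
    proof (cases "\<exists>i\<in>{1..k}. ?c i = M")
      case True
      then obtain i where i: "i \<in> {1..k}" "?c i = M" by blast
      have "g (AP_point nd i, c) = 0" if "c < M" for c
      proof (rule ccontr)
        assume "g (AP_point nd i, c) \<noteq> 0"
        then have "g (AP_point nd i, c) = 1" using g[OF i(1) that] by simp
        then have "?c i \<le> c" using that by (auto simp: first_color_def intro!: Least_le)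
        then show False using i that by simp
      qed
      then have "1 = (\<Prod>c<M. 1 - g (AP_point nd i, c))" by simp
      also have "\<dots> \<le> (\<Sum>i\<in>{1..k}. \<Prod>c<M. 1 - g (AP_point nd i, c))"
        by (rule member_le_sum[OF i(1)]) (use nn1 in auto)
      also have "\<dots> \<le> bad_weight k M g nd"
        unfolding bad_weight_def using sum_nonneg[OF nn2] by simp
      finally show ?thesis using sym by simp
    next
      case False
      then have lt: "?c i < M" if "i \<in> {1..k}" for i
        using first_color_le[of M g] that by (metis le_neq_implies_less)
      define \<sigma> where "\<sigma> = restrict ?c {1..k div 2}"
      have \<sigma>: "\<sigma> \<in> {1..k div 2} \<rightarrow>\<^sub>E {..<M}" using lt by (auto simp: \<sigma>_def)
      have "\<sigma> (fold_index k i) = ?c i" if i: "i \<in> {1..k}" for i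
      proof (cases "i \<le> k div 2")
        case True then show ?thesis using i by (simp add: \<sigma>_def fold_index_def)
      next
        case False
        then have "\<sigma> (fold_index k i) = ?c (k + 1 - i)" using i fi[OF i] by (simp add: \<sigma>_def fold_index_def)
        then show ?thesis using sym i by (simp add: sym_AP_def)
      qed
      then have "1 = (\<Prod>i\<in>{1..k}. g (AP_point nd i, \<sigma> (fold_index k i)))"
        using lt by (simp add: first_color_eq_1)
      also have "\<dots> \<le> (\<Sum>\<sigma>\<in>{1..k div 2} \<rightarrow>\<^sub>E {..<M}. \<Prod>i\<in>{1..k}. g (AP_point nd i, \<sigma> (fold_index k i)))"
        by (rule member_le_sum[OF \<sigma>]) (use nn2 in \<open>auto intro!: finite_PiE\<close>)
      also have "\<dots> \<le> bad_weight k M g nd"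
        unfolding bad_weight_def using sum_nonneg[of "{1..k}", OF nn1] by simp
      finally show ?thesis using sym by simp
    qed
  qed
qed

lemma exists_coloring_from_weights:
  fixes f :: "int \<times> nat \<Rightarrow> real"
  assumes "even k" "finite B" "\<And>nd. nd \<in> B \<Longrightarrow> snd nd \<noteq> 0" and f: "\<And>p. 0 \<le> f p \<and> f p \<le> 1"
  shows "\<exists>c. (\<forall>x. c x \<le> M) \<and> real (card {nd \<in> B. sym_AP k c nd}) \<le> (\<Sum>nd\<in>B. bad_weight k M f nd)"
proof -
  \<comment> \<open>Only the finitely many pairs of a point and a colour that \<open>B\<close> meets
    are rounded. Elsewhere the weights may stay fractional, since no progression in \<open>B\<close>
    sees them.\<close>
  define J where "J = (\<lambda>((nd, i), c). (AP_point nd i, c)) ` ((B \<times> {1..k}) \<times> {..<M})"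
  have "\<exists>g. (\<forall>j\<in>J. g j \<in> {0, 1}) \<and> (\<forall>j. j \<notin> J \<longrightarrow> g j = f j) \<and>
      (\<Sum>nd\<in>B. bad_weight k M g nd) \<le> (\<Sum>nd\<in>B. bad_weight k M f nd)"
  proof (rule multiaffine_rounding)
    show "finite J" unfolding J_def using assms(2) by simp
    fix f :: "int \<times> nat \<Rightarrow> real" and j v
    show "(\<Sum>nd\<in>B. bad_weight k M (f(j := v)) nd) =
        (1 - v) * (\<Sum>nd\<in>B. bad_weight k M (f(j := 0)) nd) + v * (\<Sum>nd\<in>B. bad_weight k M (f(j := 1)) nd)"
      unfolding sum_distrib_left sum.distrib[symmetric]
      by (rule sum.cong[OF refl], rule bad_weight_multiaffine, rule assms(3))
  qed (rule f)
  then obtain g where g: "\<forall>j\<in>J. g j \<in> {0, 1}"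
    and le: "(\<Sum>nd\<in>B. bad_weight k M g nd) \<le> (\<Sum>nd\<in>B. bad_weight k M f nd)" by blast
  have "real (card {nd \<in> B. sym_AP k (first_color M g) nd}) = (\<Sum>nd\<in>B. of_bool (sym_AP k (first_color M g) nd))"
    using assms(2) by (simp add: sum.If_cases of_bool_def Int_def)
  also have "\<dots> \<le> (\<Sum>nd\<in>B. bad_weight k M g nd)"
  proof (intro sum_mono sym_AP_bad_weight)
    show "even k" by fact
    fix nd i c assume "nd \<in> B" "i \<in> {1..k}" "c < M"
    then have "(AP_point nd i, c) \<in> J" unfolding J_def by force
    then show "g (AP_point nd i, c) \<in> {0, 1}" using g by blast
  qed
  finally show ?thesis using le first_color_le by (intro exI[of _ "first_color M g"]) auto
qed


section \<open>Expected weight of a symmetric progression\<close>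

definition weight :: "nat \<Rightarrow> (real \<times> real \<Rightarrow> real) \<Rightarrow> (nat \<Rightarrow> real) \<Rightarrow> int \<times> nat \<Rightarrow> real" where
  "weight k H w = (\<lambda>(z, c). H (frac (x_val w z), frac (y_val k w z c)))"

lemma measurable_weight:
  assumes "H \<in> borel_measurable borel" "k \<ge> 1" "c < M"
  shows "(\<lambda>w. weight k H w (z, c)) \<in> borel_measurable (cube (k + 1 + M))"
proof -
  have c: "(\<lambda>w. w j) \<in> borel_measurable (cube (k + 1 + M))" if "1 \<le> j" "j \<le> k + 1 + M" for j
    using that by (intro measurable_cube_component) simp
  have "(\<lambda>w. frac (x_val w z)) \<in> borel_measurable (cube (k + 1 + M))"
    unfolding x_val_def using assms(2)
    by (intro borel_measurable_frac borel_measurable_add borel_measurable_times c measurable_const) simp_all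
  moreover have "(\<lambda>w. frac (y_val k w z c)) \<in> borel_measurable (cube (k + 1 + M))"
    unfolding y_val_def using assms(2,3)
    by (intro borel_measurable_frac borel_measurable_add borel_measurable_sum borel_measurable_times c measurable_const) auto
  ultimately have "(\<lambda>w. (frac (x_val w z), frac (y_val k w z c))) \<in> measurable (cube (k + 1 + M)) borel"
    by (rule borel_measurable_Pair)
  from measurable_compose[OF this assms(1)] show ?thesis by (simp add: weight_def)
qed

text \<open>Coordinate \<open>2 + i\<close> belongs to the colour \<open>c + i\<close>. It is used
  with all \<open>M\<close> colours, for the joint law of the weights at a point, and with a single
  colour, for the law of one point of the plane.\<close>

definition point_matrix :: "nat \<Rightarrow> int \<Rightarrow> nat \<Rightarrow> nat \<Rightarrow> nat \<Rightarrow> int" where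
  "point_matrix k z c j = (if j = 1 then x_row z else y_row k z (c + j - 2))"

lemma torus_hom_point_matrix:
  assumes "k \<ge> 1" "c + m \<le> M"
  shows "torus_hom (k + 1 + M) (m + 1) (point_matrix k z c) w 1 = frac (x_val w z)"
    and "i < m \<Longrightarrow> torus_hom (k + 1 + M) (m + 1) (point_matrix k z c) w (2 + i) = frac (y_val k w z (c + i))"
proof -
  show "torus_hom (k + 1 + M) (m + 1) (point_matrix k z c) w 1 = frac (x_val w z)"
    using assms sum_x_row[of "k + 1 + M" z w] by (simp add: torus_hom_def point_matrix_def)
  show "torus_hom (k + 1 + M) (m + 1) (point_matrix k z c) w (2 + i) = frac (y_val k w z (c + i))" if "i < m"
    using assms that sum_y_row[of k "c + i" M z w] by (simp add: torus_hom_def point_matrix_def add.assoc)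
qed

lemma range_point_matrix:
  assumes "k \<ge> 1" "c + m \<le> M"
  shows "range (torus_hom (k + 1 + M) (m + 1) (point_matrix k z c)) = torus (m + 1)"
proof (intro equalityI subsetI)
  fix v assume "v \<in> range (torus_hom (k + 1 + M) (m + 1) (point_matrix k z c))"
  then obtain w where "v = torus_hom (k + 1 + M) (m + 1) (point_matrix k z c) w" by blast
  then show "v \<in> torus (m + 1)" by (simp add: torus_hom_def torus_def frac_lt_1)
next
  fix v assume v: "v \<in> torus (m + 1)"
  \<comment> \<open>Slope and polynomial are 0, so the base point gives the first coordinate and the
    shifts give the others directly.\<close>
  define w where "w j = (if j = 1 then v 1 else if k + 2 + c \<le> j then v (j - (k + c)) else 0)" for j
  have x: "x_val w z = v 1" using assms by (simp add: x_val_def w_def)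
  have y: "y_val k w z (c + i) = v (2 + i)" for i
  proof -
    have "(\<Sum>l<k - 1. of_int z ^ l * w (3 + l)) = 0" by (rule sum.neutral) (auto simp: w_def)
    then show ?thesis by (simp add: y_val_def w_def)
  qed
  have fv: "frac (v j) = v j" if "j \<in> {1..m + 1}" for j
    using v that by (simp add: torus_def PiE_iff frac_eq)
  have "torus_hom (k + 1 + M) (m + 1) (point_matrix k z c) w = v"
  proof
    fix j
    consider "j = 1" | i where "j = 2 + i" "i < m" | "j \<notin> {1..m + 1}"
    proof (cases "j \<in> {2..m + 1}")
      case True then show ?thesis by (intro that(2)[of "j - 2"]) auto
    next
      case False then show ?thesis using that(1,3) by fastforce
    qed
    then show "torus_hom (k + 1 + M) (m + 1) (point_matrix k z c) w j = v j"
    proof cases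
      case 1
      then show ?thesis using torus_hom_point_matrix(1)[OF assms, of z w] fv[of 1] by (simp add: x)
    next
      case 2
      then show ?thesis using torus_hom_point_matrix(2)[OF assms, of i z w] fv[of j] by (simp add: y)
    next
      case 3
      then have "v j = undefined" using v unfolding torus_def by (intro PiE_arb)
      then show ?thesis using 3 by (simp only: torus_hom_def restrict_apply if_False)
    qed
  qed
  then show "v \<in> range (torus_hom (k + 1 + M) (m + 1) (point_matrix k z c))" by (intro range_eqI[of _ _ w]) simp
qed

text \<open>The rotated point and the \<open>M\<close> shifted polynomial values are jointly uniform
  on the torus of dimension \<open>M + 1\<close>. Fixing the first, the integrals over the others
  factor, and each factor is \<open>1 - \<alpha>\<close> by the marginal condition.\<close>

lemma expectation_uncovered:
  assumes k: "k \<ge> 1" and H: "H \<in> borel_measurable borel" "\<And>p. 0 \<le> H p" "\<And>p. H p \<le> 1"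
    and marg: "AE x in circle. (\<integral>y. H (x, y) \<partial>circle) = \<alpha>"
  shows "(\<integral>w. (\<Prod>c<M. 1 - weight k H w (z, c)) \<partial>cube (k + 1 + M)) = (1 - \<alpha>) ^ M"
proof -
  define f where "f v = ennreal (\<Prod>c<M. 1 - H (v 1, v (2 + c)))" for v :: "nat \<Rightarrow> real"
  have f: "f \<in> borel_measurable (PiM {1..M + 1} (\<lambda>_. borel))"
  proof -
    have "(\<lambda>v. H (v 1, v (2 + c))) \<in> borel_measurable (PiM {1..M + 1} (\<lambda>_. borel))" if "c < M" for c
      using that by (intro measurable_compose[OF _ H(1)] borel_measurable_Pair measurable_component_singleton) simp_all
    then show ?thesis unfolding f_def
      by (intro measurable_compose[OF _ measurable_ennreal] borel_measurable_prod borel_measurable_diff measurable_const) simp_all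
  qed
  have Hy: "(\<lambda>y. H (x, y)) \<in> borel_measurable borel" for x
    by (intro measurable_compose[OF _ H(1)]) simp
  have Hc: "(\<lambda>y. H (x, y)) \<in> borel_measurable circle" for x
    using Hy by (simp add: measurable_cong_sets[OF sets_circle refl])
  have iH: "integrable circle (\<lambda>y. H (x, y))" for x
    by (rule circle.integrable_const_bound[where B = 1]) (use H(2,3) Hc in auto)
  \<comment> \<open>Follows from \<open>H \<le> 1\<close> on a single good slice; it keeps the
    conversion between \<open>ennreal\<close> and \<open>real\<close> faithful.\<close>
  have \<alpha>: "0 \<le> 1 - \<alpha>"
  proof -
    obtain x where "(\<integral>y. H (x, y) \<partial>circle) = \<alpha>"
      using eventually_happens[OF marg] circle.ae_filter_bot by blast
    moreover have "(\<integral>y. H (x, y) \<partial>circle) \<le> 1"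
      by (rule circle.integral_le_const[OF iH]) (simp add: H)
    ultimately show ?thesis by simp
  qed
  have ins: "{1..M + 1} = insert 1 {2..M + 1}" by auto
  have "(\<integral>\<^sup>+ w. ennreal (\<Prod>c<M. 1 - weight k H w (z, c)) \<partial>cube (k + 1 + M)) =
      (\<integral>\<^sup>+ w. f (torus_hom (k + 1 + M) (M + 1) (point_matrix k z 0) w) \<partial>cube (k + 1 + M))"
  proof (rule nn_integral_cong)
    fix w
    show "ennreal (\<Prod>c<M. 1 - weight k H w (z, c)) = f (torus_hom (k + 1 + M) (M + 1) (point_matrix k z 0) w)"
      unfolding f_def weight_def
      using torus_hom_point_matrix(1)[OF k, of 0 M M z w]
        torus_hom_point_matrix(2)[OF k, where c = 0 and m = M and M = M and z = z and w = w] by simp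
  qed
  also have "\<dots> = (\<integral>\<^sup>+ v. f v \<partial>cube (M + 1))"
    by (rule cube_integral_torus_hom[OF range_point_matrix f]) (use k in simp_all)
  also have "\<dots> = (\<integral>\<^sup>+ x. (\<integral>\<^sup>+ v. f (v(1 := x)) \<partial>PiM {2..M + 1} (\<lambda>_. circle)) \<partial>circle)"
  proof -
    have "f \<in> borel_measurable (PiM (insert 1 {2..M + 1}) (\<lambda>_. circle))"
      using f measurable_cong_sets[OF sets_cube[of "M + 1"] refl, of borel] unfolding cube_def ins by simp
    then show ?thesis
      unfolding cube_def ins by (intro circles.product_nn_integral_insert_rev) simp_all
  qed
  also have "\<dots> = (\<integral>\<^sup>+ x. ennreal ((1 - \<alpha>) ^ M) \<partial>circle)"
  proof (rule nn_integral_cong_AE, use marg in eventually_elim)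
    fix x assume x: "(\<integral>y. H (x, y) \<partial>circle) = \<alpha>"
    have "(\<integral>\<^sup>+ v. f (v(1 := x)) \<partial>PiM {2..M + 1} (\<lambda>_. circle)) =
        (\<integral>\<^sup>+ v. (\<Prod>j\<in>{2..M + 1}. ennreal (1 - H (x, v j))) \<partial>PiM {2..M + 1} (\<lambda>_. circle))"
    proof (rule nn_integral_cong)
      fix v :: "nat \<Rightarrow> real"
      have "f (v(1 := x)) = (\<Prod>c<M. ennreal (1 - H (x, v (2 + c))))"
        using H(3) by (simp add: f_def prod_ennreal)
      also have "\<dots> = (\<Prod>j\<in>{2..M + 1}. ennreal (1 - H (x, v j)))"
        by (rule prod.reindex_bij_witness[of _ "\<lambda>j. j - 2" "\<lambda>c. 2 + c"]) auto
      finally show "f (v(1 := x)) = (\<Prod>j\<in>{2..M + 1}. ennreal (1 - H (x, v j)))" .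
    qed
    also have "\<dots> = (\<Prod>j\<in>{2..M + 1}. (\<integral>\<^sup>+ u. ennreal (1 - H (x, u)) \<partial>circle))"
      by (rule circles.product_nn_integral_prod) (use Hc in simp_all)
    also have "(\<integral>\<^sup>+ u. ennreal (1 - H (x, u)) \<partial>circle) = ennreal (1 - \<alpha>)"
      using H(3) iH x by (subst nn_integral_eq_integral) (simp_all add: circle.prob_space[simplified])
    also have "(\<Prod>j\<in>{2..M + 1}. ennreal (1 - \<alpha>)) = ennreal ((1 - \<alpha>) ^ M)"
      using \<alpha> by (simp add: ennreal_power)
    finally show "(\<integral>\<^sup>+ v. f (v(1 := x)) \<partial>PiM {2..M + 1} (\<lambda>_. circle)) = ennreal ((1 - \<alpha>) ^ M)" .
  qed
  also have "\<dots> = ennreal ((1 - \<alpha>) ^ M)" by (simp add: circle.emeasure_space_1[simplified])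
  finally have *: "(\<integral>\<^sup>+ w. ennreal (\<Prod>c<M. 1 - weight k H w (z, c)) \<partial>cube (k + 1 + M)) = ennreal ((1 - \<alpha>) ^ M)" .
  have "(\<integral>w. (\<Prod>c<M. 1 - weight k H w (z, c)) \<partial>cube (k + 1 + M)) =
      enn2real (\<integral>\<^sup>+ w. ennreal (\<Prod>c<M. 1 - weight k H w (z, c)) \<partial>cube (k + 1 + M))"
  proof (rule integral_eq_nn_integral)
    show "(\<lambda>w. \<Prod>c<M. 1 - weight k H w (z, c)) \<in> borel_measurable (cube (k + 1 + M))"
      using k H(1) by (intro borel_measurable_prod borel_measurable_diff measurable_const measurable_weight) simp_all
    show "AE w in cube (k + 1 + M). 0 \<le> (\<Prod>c<M. 1 - weight k H w (z, c))"
      using H(3) by (intro AE_I2 prod_nonneg) (simp add: weight_def)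
  qed
  then show ?thesis unfolding * using \<alpha> by simp
qed

text \<open>The value is the same for all progressions and all symmetric patterns because the image
  of the matrix is always \<open>V k\<close>. Besides this change of variables, the proof replaces
  \<open>F\<close> by \<open>H\<close> and removes the completion.\<close>

lemma expectation_AP:
  assumes k: "k \<ge> 2" "even k" and d: "snd nd \<noteq> 0"
    and \<sigma>: "\<And>i. i \<in> {1..k} \<Longrightarrow> \<sigma> i < M" "\<And>i. i \<in> {1..k} \<Longrightarrow> \<sigma> (k + 1 - i) = \<sigma> i"
    and H: "H \<in> borel_measurable borel"
    and FH: "AE p in lborel. p \<in> {0..<1} \<times> {0..<1} \<longrightarrow> F p = H p"
  shows "(\<integral>w. (\<Prod>i\<in>{1..k}. weight k H w (AP_point nd i, \<sigma> i)) \<partial>cube (k + 1 + M)) = Lambda k F"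
proof -
  let ?K = "k + 1 + M"
  let ?z = "AP_point nd"
  let ?\<phi> = "torus_hom ?K (2 * k) (AP_matrix k ?z \<sigma>)"
  have k1: "k \<ge> 1" using k by simp
  have range: "range ?\<phi> = V k"
  proof (rule range_AP_matrix[where n = "fst nd" and d = "snd nd"])
    show "\<sigma> i < M" "\<sigma> (k + 1 - i) = \<sigma> i" if "i \<in> {1..k}" for i
      using \<sigma>[OF that] by simp_all
  qed (use k d in \<open>simp_all add: AP_point_def\<close>)
  have hom: "?\<phi> w i = frac (x_val w (?z i))" "?\<phi> w (k + i) = frac (y_val k w (?z i) (\<sigma> i))"
    if "i \<in> {1..k}" for w i
    using torus_hom_AP_matrix[of k \<sigma> M i ?z w] k1 \<sigma>(1) that by auto
  note haar = haar_measure_torus_hom[OF range]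
  have meas: "?\<phi> \<in> measurable (cube ?K) (sub_borel (2 * k) (V k))"
    using range by (intro measurable_restrict_space2 measurable_torus_hom) auto
  have comp: "(\<lambda>v. (v i, v (k + i))) \<in> measurable (sub_borel (2 * k) (V k)) borel" if "i \<in> {1..k}" for i
    using that by (intro borel_measurable_Pair measurable_restrict_space1 measurable_component_singleton) simp_all
  let ?f = "\<lambda>v. \<Prod>i=1..k. F (v i, v (k + i))" and ?g = "\<lambda>v. \<Prod>i=1..k. H (v i, v (k + i))"
  have g: "?g \<in> borel_measurable (haar_measure (2 * k) (V k))"
    unfolding haar using H comp
    by (intro borel_measurable_prod) (auto intro: measurable_compose)
  obtain N where N: "N \<in> sets borel" "(\<integral>\<^sup>+ v. indicator N (v 1, v 2) \<partial>cube 2) = 0"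
    "\<And>p. p \<in> {0..<1} \<times> {0..<1} \<Longrightarrow> p \<notin> N \<Longrightarrow> F p = H p"
    by (rule AE_cube_2[OF FH]) blast
  \<comment> \<open>For each \<open>i\<close> by itself, the pair is uniform on the two-dimensional
    torus, by \<open>point_matrix\<close> with one colour, so it almost surely avoids the planar
    null set.\<close>
  have "AE v in haar_measure (2 * k) (V k). (v i, v (k + i)) \<notin> N" if i: "i \<in> {1..k}" for i
  proof -
    let ?h = "\<lambda>v. indicator N (v i, v (k + i)) :: ennreal"
    let ?\<psi> = "torus_hom ?K (1 + 1) (point_matrix k (?z i) (\<sigma> i))"
    have \<sigma>i: "\<sigma> i + 1 \<le> M" using \<sigma>(1)[OF i] by simp
    have h: "?h \<in> borel_measurable (sub_borel (2 * k) (V k))"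
      using comp[OF i] N(1) by (intro measurable_compose[OF comp[OF i]] borel_measurable_indicator)
    have h2: "(\<lambda>v :: nat \<Rightarrow> real. indicator N (v 1, v 2) :: ennreal) \<in> borel_measurable (PiM {1..1 + 1} (\<lambda>_. borel))"
      using N(1) by (intro measurable_compose[OF _ borel_measurable_indicator] borel_measurable_Pair measurable_component_singleton) auto
    have "(\<integral>\<^sup>+ v. ?h v \<partial>haar_measure (2 * k) (V k)) = (\<integral>\<^sup>+ w. ?h (?\<phi> w) \<partial>cube ?K)"
      unfolding haar by (rule nn_integral_distr[OF meas]) (use h in simp)
    also have "\<dots> = (\<integral>\<^sup>+ w. indicator N (?\<psi> w 1, ?\<psi> w 2) \<partial>cube ?K)"
    proof (rule nn_integral_cong)
      fix w
      show "?h (?\<phi> w) = indicator N (?\<psi> w 1, ?\<psi> w 2)"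
        using hom[OF i, of w] torus_hom_point_matrix(1)[OF k1 \<sigma>i, of "?z i" w]
          torus_hom_point_matrix(2)[OF k1 \<sigma>i, where i = 0 and z = "?z i" and w = w]
        by simp
    qed
    also have "\<dots> = (\<integral>\<^sup>+ v. indicator N (v 1, v 2) \<partial>cube (1 + 1))"
      by (rule cube_integral_torus_hom[OF range_point_matrix[OF k1 \<sigma>i] h2])
    also have "\<dots> = 0" using N(2) by (simp add: one_add_one)
    finally have "(\<integral>\<^sup>+ v. ?h v \<partial>haar_measure (2 * k) (V k)) = 0" .
    then have "AE v in haar_measure (2 * k) (V k). ?h v = 0"
      by (subst (asm) nn_integral_0_iff_AE) (use h in \<open>simp_all add: haar\<close>)
    then show ?thesis by eventually_elim (simp add: indicator_def split: if_splits)
  qed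
  then have "AE v in haar_measure (2 * k) (V k). \<forall>i\<in>{1..k}. (v i, v (k + i)) \<notin> N"
    by (intro AE_finite_allI) simp_all
  moreover have "AE v in haar_measure (2 * k) (V k). v \<in> V k"
    unfolding haar by (rule AE_I2) (simp add: space_restrict_space)
  ultimately have ae: "AE v in haar_measure (2 * k) (V k). ?f v = ?g v"
  proof eventually_elim
    case (elim v)
    show ?case
    proof (rule prod.cong[OF refl], rule N(3))
      fix i assume i: "i \<in> {1..k}"
      then have "i \<in> {1..2 * k}" "k + i \<in> {1..2 * k}" by auto
      moreover have "v \<in> {1..2 * k} \<rightarrow>\<^sub>E {0..<1}" using elim(2) by (simp add: V_def torus_def)
      ultimately have "v i \<in> {0..<1}" "v (k + i) \<in> {0..<1}" by (blast dest: PiE_mem)+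
      then show "(v i, v (k + i)) \<in> {0..<1} \<times> {0..<1}" by blast
      show "(v i, v (k + i)) \<notin> N" using elim(1) i by blast
    qed
  qed
  have "Lambda k F = (\<integral>v. ?g v \<partial>completion (haar_measure (2 * k) (V k)))"
    unfolding Lambda_def
  proof (rule integral_cong_AE)
    show "?f \<in> borel_measurable (completion (haar_measure (2 * k) (V k)))"
      by (rule borel_measurable_completion_AE[OF g ae])
    show "?g \<in> borel_measurable (completion (haar_measure (2 * k) (V k)))"
      by (rule measurable_completion[OF g])
    show "AE v in completion (haar_measure (2 * k) (V k)). ?f v = ?g v"
      by (rule AE_completion[OF ae])
  qed
  also have "\<dots> = (\<integral>v. ?g v \<partial>haar_measure (2 * k) (V k))" by (rule integral_completion[OF g])
  also have "\<dots> = (\<integral>w. ?g (?\<phi> w) \<partial>cube ?K)"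
    using g unfolding haar by (intro integral_distr[OF meas]) simp
  also have "\<dots> = (\<integral>w. (\<Prod>i\<in>{1..k}. weight k H w (?z i, \<sigma> i)) \<partial>cube ?K)"
  proof (intro Bochner_Integration.integral_cong refl prod.cong)
    fix w i assume "i \<in> {1..k}"
    from hom[OF this, of w] show "H (?\<phi> w i, ?\<phi> w (k + i)) = weight k H w (?z i, \<sigma> i)"
      by (simp add: weight_def)
  qed
  finally show ?thesis ..
qed

text \<open>First moment method: some parameter \<open>w\<close> has total bad weight at most about
  the mean, and its weights are then rounded to a colouring. There are \<open>M ^ (k div 2)\<close>
  symmetric patterns, each contributing \<open>Lambda k F\<close>.\<close>

lemma exists_coloring_step:
  assumes k: "k \<ge> 2" "even k" and F: "admissible \<alpha> F" and M: "M > 0" and L: "Lambda k F < L"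
    and B: "finite B" "\<And>nd. nd \<in> B \<Longrightarrow> snd nd \<noteq> 0"
  shows "\<exists>c. (\<forall>x. c x \<le> M) \<and>
    real (card {nd \<in> B. sym_AP k c nd}) \<le> (real k * (1 - \<alpha>) ^ M + real (M ^ (k div 2)) * L) * real (card B)"
proof (cases "B = {}")
  case True
  then show ?thesis by (intro exI[of _ "\<lambda>_. 0"]) simp
next
  case False
  obtain H where H: "H \<in> borel_measurable borel" "\<And>p. 0 \<le> H p" "\<And>p. H p \<le> 1"
    "AE p in lborel. p \<in> {0..<1} \<times> {0..<1} \<longrightarrow> F p = H p"
    by (rule admissible_ex_borel[OF F]) blast
  note marg = borel_marginal[OF F H]
  let ?K = "k + 1 + M"
  let ?S = "{1..k div 2} \<rightarrow>\<^sub>E {..<M}"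
  let ?p = "real k * (1 - \<alpha>) ^ M + real (M ^ (k div 2)) * L"
  have k1: "k \<ge> 1" using k by simp
  have W: "0 \<le> weight k H w p" "weight k H w p \<le> 1" for w p
    using H by (auto simp: weight_def split: prod.split)
  have fold: "fold_index k i \<in> {1..k div 2}" "fold_index k (k + 1 - i) = fold_index k i" if "i \<in> {1..k}" for i
    using that \<open>even k\<close> by (auto simp: fold_index_def elim!: evenE)
  have \<sigma>M: "\<sigma> (fold_index k i) < M" if "\<sigma> \<in> ?S" "i \<in> {1..k}" for \<sigma> i
    using PiE_mem[OF that(1) fold(1)[OF that(2)]] by simp
  have int1: "integrable (cube ?K) (\<lambda>w. \<Prod>c<M. 1 - weight k H w (x, c))" for x
  proof (rule cube.integrable_const_bound[where B = 1])
    show "AE w in cube ?K. norm (\<Prod>c<M. 1 - weight k H w (x, c)) \<le> 1"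
      using W by (intro AE_I2) (auto simp: abs_prod intro!: prod_le_1)
    show "(\<lambda>w. \<Prod>c<M. 1 - weight k H w (x, c)) \<in> borel_measurable (cube ?K)"
      using k1 H(1) by (intro borel_measurable_prod borel_measurable_diff measurable_const measurable_weight) simp_all
  qed
  have int2: "integrable (cube ?K) (\<lambda>w. \<Prod>i\<in>{1..k}. weight k H w (AP_point nd i, \<sigma> (fold_index k i)))"
    if "\<sigma> \<in> ?S" for nd \<sigma>
  proof (rule cube.integrable_const_bound[where B = 1])
    show "AE w in cube ?K. norm (\<Prod>i\<in>{1..k}. weight k H w (AP_point nd i, \<sigma> (fold_index k i))) \<le> 1"
      using W by (intro AE_I2) (auto simp: abs_prod intro!: prod_le_1)
    show "(\<lambda>w. \<Prod>i\<in>{1..k}. weight k H w (AP_point nd i, \<sigma> (fold_index k i))) \<in> borel_measurable (cube ?K)"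
      by (intro borel_measurable_prod measurable_weight[OF H(1) k1] \<sigma>M[OF that])
  qed
  have bw: "integrable (cube ?K) (\<lambda>w. bad_weight k M (weight k H w) nd)" for nd
    unfolding bad_weight_def
    by (intro Bochner_Integration.integrable_add Bochner_Integration.integrable_sum int1 int2)
  have E: "(\<integral>w. bad_weight k M (weight k H w) nd \<partial>cube ?K) =
      real k * (1 - \<alpha>) ^ M + real (M ^ (k div 2)) * Lambda k F" if "nd \<in> B" for nd
  proof -
    have "(\<integral>w. bad_weight k M (weight k H w) nd \<partial>cube ?K) =
       (\<Sum>i\<in>{1..k}. (\<integral>w. (\<Prod>c<M. 1 - weight k H w (AP_point nd i, c)) \<partial>cube ?K)) +
       (\<Sum>\<sigma>\<in>?S. (\<integral>w. (\<Prod>i\<in>{1..k}. weight k H w (AP_point nd i, \<sigma> (fold_index k i))) \<partial>cube ?K))"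
      unfolding bad_weight_def
      by (subst Bochner_Integration.integral_add)
        (simp_all add: Bochner_Integration.integral_sum Bochner_Integration.integrable_sum int1 int2)
    also have "\<dots> = (\<Sum>i\<in>{1..k}. (1 - \<alpha>) ^ M) + (\<Sum>\<sigma>\<in>?S. Lambda k F)"
    proof (intro arg_cong2[where f = "(+)"] sum.cong refl)
      fix i
      show "(\<integral>w. (\<Prod>c<M. 1 - weight k H w (AP_point nd i, c)) \<partial>cube ?K) = (1 - \<alpha>) ^ M"
        by (rule expectation_uncovered[OF k1 H(1-3) marg])
    next
      fix \<sigma> assume \<sigma>: "\<sigma> \<in> ?S"
      show "(\<integral>w. (\<Prod>i\<in>{1..k}. weight k H w (AP_point nd i, \<sigma> (fold_index k i))) \<partial>cube ?K) = Lambda k F"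
        by (rule expectation_AP[OF k B(2)[OF that] \<sigma>M[OF \<sigma>] _ H(1) H(4)]) (simp_all add: fold)
    qed
    also have "\<dots> = real k * (1 - \<alpha>) ^ M + real (M ^ (k div 2)) * Lambda k F"
      by (simp add: card_PiE)
    finally show ?thesis .
  qed
  let ?G = "\<lambda>w. \<Sum>nd\<in>B. bad_weight k M (weight k H w) nd"
  \<comment> \<open>The strict inequality between \<open>Lambda k F\<close> and \<open>L\<close>,
    with \<open>M > 0\<close> and \<open>B\<close> nonempty, puts the mean strictly below the
    bound.\<close>
  have "\<exists>w. ?G w < ?p * real (card B)"
  proof (rule ccontr)
    assume "\<not> ?thesis"
    then have "?p * real (card B) \<le> (\<integral>w. ?G w \<partial>cube ?K)"
      by (intro cube.integral_ge_const Bochner_Integration.integrable_sum bw AE_I2) (simp add: not_less)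
    also have "\<dots> = (\<Sum>nd\<in>B. (\<integral>w. bad_weight k M (weight k H w) nd \<partial>cube ?K))"
      by (rule Bochner_Integration.integral_sum) (rule bw)
    also have "\<dots> = (real k * (1 - \<alpha>) ^ M + real (M ^ (k div 2)) * Lambda k F) * real (card B)"
      by (simp add: E)
    also have "\<dots> < ?p * real (card B)"
      using False B(1) M L by (intro mult_strict_right_mono add_strict_left_mono mult_strict_left_mono) (simp_all add: card_gt_0_iff)
    finally show False by simp
  qed
  then obtain w where w: "?G w < ?p * real (card B)" by blast
  have "\<exists>c. (\<forall>x. c x \<le> M) \<and> real (card {nd \<in> B. sym_AP k c nd}) \<le> ?G w"
    by (rule exists_coloring_from_weights[OF k(2) B]) (use W in simp_all)
  then obtain c where "\<forall>x. c x \<le> M" "real (card {nd \<in> B. sym_AP k c nd}) \<le> ?G w" by blast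
  with w show ?thesis by (intro exI[of _ c]) auto
qed


section \<open>Iteration and reduction from residues to integers\<close>

text \<open>Each round is applied only to the progressions that are still symmetric, so the factor
  \<open>p\<close> is gained every time without any independence between rounds.\<close>

lemma exists_coloring_iterate:
  assumes step: "\<And>B. finite B \<Longrightarrow> (\<And>nd. nd \<in> B \<Longrightarrow> snd nd \<noteq> 0) \<Longrightarrow>
      \<exists>c. (\<forall>x. c x \<le> M) \<and> real (card {nd \<in> B. sym_AP k c nd}) \<le> p * real (card B)"
    and p: "0 \<le> p" and B: "finite B" "\<And>nd. nd \<in> B \<Longrightarrow> snd nd \<noteq> 0"
  shows "\<exists>c. (\<forall>x. c x < (M + 1) ^ m) \<and> real (card {nd \<in> B. sym_AP k c nd}) \<le> p ^ m * real (card B)"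
proof (induction m)
  case 0
  have "card {nd \<in> B. sym_AP k (\<lambda>_. 0) nd} \<le> card B" using B(1) by (intro card_mono) auto
  then show ?case by (intro exI[of _ "\<lambda>_. 0"]) simp
next
  case (Suc m)
  then obtain c where c: "\<And>x. c x < (M + 1) ^ m" "real (card {nd \<in> B. sym_AP k c nd}) \<le> p ^ m * real (card B)"
    by blast
  let ?B = "{nd \<in> B. sym_AP k c nd}"
  obtain e where e: "\<And>x. e x \<le> M" "real (card {nd \<in> ?B. sym_AP k e nd}) \<le> p * real (card ?B)"
    using step[of ?B] B by auto
  \<comment> \<open>The pair of colours is encoded as quotient and remainder by
    \<open>M + 1\<close>; a progression symmetric for \<open>f\<close> is symmetric for both
    components.\<close>
  define f where "f x = e x + c x * (M + 1)" for x
  have f: "f x div (M + 1) = c x" "f x mod (M + 1) = e x" for x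
  proof -
    have "e x < M + 1" using e(1)[of x] by simp
    then show "f x div (M + 1) = c x" "f x mod (M + 1) = e x"
      by (simp_all only: f_def div_mult_self1 mod_mult_self1 div_less mod_less add_0_right
          add_is_0 one_neq_zero simp_thms)
  qed
  have "c x = c y \<and> e x = e y" if "f x = f y" for x y using that f by metis
  then have "{nd \<in> B. sym_AP k f nd} \<subseteq> {nd \<in> ?B. sym_AP k e nd}"
    unfolding sym_AP_def by blast
  then have "card {nd \<in> B. sym_AP k f nd} \<le> card {nd \<in> ?B. sym_AP k e nd}"
    using B(1) by (intro card_mono) auto
  then have "real (card {nd \<in> B. sym_AP k f nd}) \<le> p * real (card ?B)" using e(2) by linarith
  also have "\<dots> \<le> p * (p ^ m * real (card B))" using c(2) p by (rule mult_left_mono)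
  finally have 1: "real (card {nd \<in> B. sym_AP k f nd}) \<le> p ^ Suc m * real (card B)" by simp
  have "f x < (M + 1) ^ Suc m" for x
  proof -
    have "f x < (c x + 1) * (M + 1)" using e(1)[of x] by (simp add: f_def algebra_simps)
    also have "\<dots> \<le> (M + 1) ^ m * (M + 1)" using c(1)[of x] by (intro mult_right_mono) auto
    finally show ?thesis by (simp add: mult.commute)
  qed
  with 1 show ?case by (intro exI[of _ f]) blast
qed

section \<open>Excluding wrap-around modulo \<open>N\<close>\<close>

text \<open>The quotient \<open>x * K div N\<close> numbers the blocks of length
  \<open>N / K\<close> even if \<open>K\<close> does not divide \<open>N\<close>.\<close>

lemma same_block_diff:
  fixes x y :: nat
  assumes "x * K div N = y * K div N" "N > 0"
  shows "\<bar>int x - int y\<bar> * int K < int N"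
proof -
  have "\<bar>int (x * K) - int (y * K)\<bar> < int N"
  proof -
    have "int (x * K) = int N * int (y * K div N) + int (x * K mod N)"
      using assms(1) by (metis mult_div_mod_eq of_nat_add of_nat_mult)
    moreover have "int (y * K) = int N * int (y * K div N) + int (y * K mod N)"
      by (metis mult_div_mod_eq of_nat_add of_nat_mult)
    moreover have "x * K mod N < N" "y * K mod N < N" using assms(2) by auto
    ultimately show ?thesis by linarith
  qed
  also have "\<bar>int (x * K) - int (y * K)\<bar> = \<bar>int x - int y\<bar> * int K"
    by (simp add: left_diff_distrib[symmetric] abs_mult)
  finally show ?thesis by simp
qed

text \<open>Colouring additionally by blocks of length \<open>N / (2 * k)\<close> forces the two middle points and the
  two end points of a symmetrically coloured progression to be close, so that it does not wrap
  around modulo \<open>N\<close>.\<close>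

lemma no_symmetric_AP_blocks:
  fixes c :: "int \<Rightarrow> nat"
  assumes k: "k \<ge> 2" "even k" and c: "\<And>x. c x < R"
    and none: "\<And>n d. 0 \<le> n \<Longrightarrow> n < int N \<Longrightarrow> d \<noteq> 0 \<Longrightarrow> \<bar>d\<bar> < int N \<Longrightarrow> \<not> sym_AP k c (n, d)"
  shows "\<not> has_symmetric_AP N k (\<lambda>x. (x * (2 * k) div N) * R + c (int x))"
proof
  let ?c = "\<lambda>x. (x * (2 * k) div N) * R + c (int x)"
  assume "has_symmetric_AP N k ?c"
  then obtain n d where nd: "n < N" "d < N" "d \<noteq> 0" "symmetric_AP N k ?c n d"
    by (auto simp: has_symmetric_AP_def)
  have N: "N > 0" using nd by simp
  define z where "z i = (n + (i - 1) * d) mod N" for i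
  have zN: "z i < N" for i using N by (simp add: z_def)
  have split: "x * (2 * k) div N = y * (2 * k) div N \<and> c (int x) = c (int y)" if "?c x = ?c y" for x y
  proof -
    have *: "?c x div R = x * (2 * k) div N" "?c x mod R = c (int x)" for x using c[of "int x"] by simp_all
    have "?c x div R = ?c y div R" "?c x mod R = ?c y mod R"
      using that by (rule arg_cong[where f = "\<lambda>u. u div R"], rule arg_cong[where f = "\<lambda>u. u mod R"])
    then show ?thesis unfolding * by blast
  qed
  have sym: "?c (z i) = ?c (z (k + 1 - i))" if "i \<in> {1..k div 2}" for i
  proof -
    have "k + 1 - i - 1 = k - i" by simp
    with nd(4) that show ?thesis unfolding symmetric_AP_def z_def by (simp only:)
  qed
  define h where "h = k div 2"
  have h: "k = 2 * h" "h \<ge> 1" using k by (auto simp: h_def)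
  have close: "\<bar>int (z i) - int (z (k + 1 - i))\<bar> * int (2 * k) < int N" if "i \<in> {1..h}" for i
    using split[OF sym] that N by (intro same_block_diff) (simp_all add: h_def)
  \<comment> \<open>The small, possibly negative, representative of \<open>d\<close> modulo
    \<open>N\<close>, read off from the two middle points; their common block gives its absolute
    value less than \<open>N / (2 * k)\<close>.\<close>
  define D where "D = int (z (h + 1)) - int (z h)"
  define a where "a = int (z 1)"
  have zc: "[int (z i) = int n + (int i - 1) * int d] (mod int N)" if "i \<ge> 1" for i
    using that by (simp add: z_def cong_def zmod_int of_nat_diff)
  have Dc: "[D = int d] (mod int N)"
  proof -
    have "[D = (int n + (int (h + 1) - 1) * int d) - (int n + (int h - 1) * int d)] (mod int N)"
      unfolding D_def by (intro cong_diff zc) (use h in auto)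
    then show ?thesis by (simp add: algebra_simps)
  qed
  have D0: "D \<noteq> 0"
  proof
    assume "D = 0"
    then have "[int d = 0] (mod int N)" using cong_sym[OF Dc] by simp
    then show False using nd(2,3) by (simp add: cong_0_iff nat_dvd_not_less)
  qed
  have DN: "\<bar>D\<bar> * int (2 * k) < int N"
    using close[of h] h by (simp add: D_def abs_minus_commute)
  have "\<bar>D\<bar> * 1 \<le> \<bar>D\<bar> * int (2 * k)" using k by (intro mult_left_mono) auto
  then have D1: "\<bar>D\<bar> < int N" using DN by linarith
  have end_close: "\<bar>a - int (z k)\<bar> * int (2 * k) < int N"
    using close[of 1] h by (simp add: a_def)
  have zD: "[int (z i) = a + (int i - 1) * D] (mod int N)" if "i \<ge> 1" for i
  proof -
    have "[a + (int i - 1) * D = (int n + (int 1 - 1) * int d) + (int i - 1) * int d] (mod int N)"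
      unfolding a_def by (intro cong_add cong_mult zc Dc cong_refl) simp
    then have "[a + (int i - 1) * D = int n + (int i - 1) * int d] (mod int N)" by simp
    then show ?thesis using zc[OF that] by (rule cong_trans[OF _ cong_sym, rotated])
  qed
  \<comment> \<open>The difference \<open>?e\<close> is a multiple of \<open>N\<close>. The end
    points contribute less than \<open>N / (2 * k)\<close> to it and the \<open>k - 1\<close> steps
    less than \<open>(k - 1) * N / (2 * k)\<close>, in total less than \<open>N\<close>, so it is
    0.\<close>
  have ends: "int (z k) = a + (int k - 1) * D"
  proof -
    let ?e = "int (z k) - (a + (int k - 1) * D)"
    have dvd: "int N dvd ?e" using zD[of k] k by (simp add: cong_iff_dvd_diff)
    have "\<bar>?e\<bar> \<le> \<bar>a - int (z k)\<bar> + (int k - 1) * \<bar>D\<bar>"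
    proof -
      have "\<bar>(int k - 1) * D\<bar> = (int k - 1) * \<bar>D\<bar>" using k by (simp add: abs_mult)
      then show ?thesis by linarith
    qed
    then have "\<bar>?e\<bar> * int (2 * k) \<le> (\<bar>a - int (z k)\<bar> + (int k - 1) * \<bar>D\<bar>) * int (2 * k)"
      by (intro mult_right_mono) auto
    also have "\<dots> = \<bar>a - int (z k)\<bar> * int (2 * k) + (int k - 1) * (\<bar>D\<bar> * int (2 * k))"
      by (simp add: algebra_simps)
    also have "\<dots> < int N + (int k - 1) * int N"
    proof -
      have "(int k - 1) * (\<bar>D\<bar> * int (2 * k)) \<le> (int k - 1) * int N"
        using DN k by (intro mult_left_mono) auto
      then show ?thesis using end_close by linarith
    qed
    also have "\<dots> = int N * int k" by (simp add: algebra_simps)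
    also have "\<dots> \<le> int N * int (2 * k)" by (intro mult_left_mono) auto
    finally have "\<bar>?e\<bar> < int N" by (simp add: mult_less_cancel_right)
    then have "?e = 0" using dvd dvd_imp_le_int[of ?e "int N"] by linarith
    then show ?thesis by simp
  qed
  \<comment> \<open>Each point lies between the two end points, hence in \<open>{0..<N}\<close>,
    where congruence modulo \<open>N\<close> is equality.\<close>
  have pt: "AP_point (a, D) i = int (z i)" if i: "i \<in> {1..k}" for i
  proof -
    let ?y = "a + (int i - 1) * D"
    have "0 \<le> ?y \<and> ?y < int N"
    proof (cases "D \<ge> 0")
      case True
      have "0 \<le> (int i - 1) * D" "(int i - 1) * D \<le> (int k - 1) * D"
        using True i by (auto intro: mult_right_mono)
      then show ?thesis using ends zN[of k] zN[of 1] unfolding a_def by linarith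
    next
      case False
      have "(int i - 1) * D \<le> 0" "(int k - 1) * D \<le> (int i - 1) * D"
        using False i by (auto intro: mult_right_mono_neg mult_nonneg_nonpos)
      then show ?thesis using ends zN[of k] zN[of 1] unfolding a_def by linarith
    qed
    then have "?y mod int N = ?y" "int (z i) mod int N = int (z i)" using zN[of i] by auto
    then have "int (z i) = ?y" using zD[of i] i by (simp add: cong_def)
    then show ?thesis by (simp add: AP_point_def)
  qed
  have "sym_AP k c (a, D)"
    unfolding sym_AP_def
  proof
    fix i assume i: "i \<in> {1..k}"
    show "c (AP_point (a, D) i) = c (AP_point (a, D) (k + 1 - i))"
    proof (cases "i \<le> h")
      case True
      then have "i \<in> {1..k div 2}" "k + 1 - i \<in> {1..k}" using i by (auto simp: h_def)
      then show ?thesis using split[OF sym[of i]] pt[OF i] pt[of "k + 1 - i"] by simp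
    next
      case False
      then have "k + 1 - i \<in> {1..k div 2}" "k + 1 - (k + 1 - i) = i" "k + 1 - i \<in> {1..k}" using i h by auto
      then show ?thesis using split[OF sym[of "k + 1 - i"]] pt[OF i] pt[of "k + 1 - i"] by simp
    qed
  qed
  moreover have "\<not> sym_AP k c (a, D)"
    by (rule none) (use zN[of 1] D0 D1 in \<open>simp_all add: a_def\<close>)
  ultimately show False by contradiction
qed

section \<open>Choice of the number of rounds and of the density\<close>

text \<open>With \<beta> \<open>* ln N\<close> rounds, killing \<open>2 * N ^ 2\<close> progressions
  requires \<beta> above \<open>2 / (- ln p)\<close>, and the colour budget requires \<beta> below
  \<open>\<gamma> / ln r\<close>. The condition on \<open>r\<close> and \<open>p\<close> says that
  such a \<beta> exists; strictness on both sides absorbs the constants 2 and \<open>K\<close> and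
  the rounding up.\<close>

lemma eventually_number_of_rounds:
  fixes p \<gamma> K :: real and r :: nat
  assumes p: "0 < p" "p < 1" and r: "r > 1" and rp: "real r ^ 2 * p powr \<gamma> < 1" and \<gamma>: "\<gamma> > 0"
  shows "\<forall>\<^sub>F N in sequentially. \<exists>m. 2 * real N ^ 2 * p ^ m < 1 \<and> K * real r ^ m \<le> real N powr \<gamma>"
proof -
  define P where "P = - ln p"
  have P: "P > 0" using p by (simp add: P_def)
  have lr: "ln (real r) > 0" using r by simp
  have "ln (real r ^ 2 * p powr \<gamma>) < 0" using rp p r by (subst ln_less_zero_iff) auto
  then have "2 * ln (real r) < \<gamma> * P"
    using p r by (simp add: P_def ln_mult ln_powr ln_realpow)
  then have "2 / P < \<gamma> / ln (real r)" using P lr by (simp add: field_simps)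
  then obtain \<beta> where \<beta>: "2 / P < \<beta>" "\<beta> < \<gamma> / ln (real r)" using dense by blast
  have b1: "2 - P * \<beta> < 0" using \<beta>(1) P by (simp add: field_simps)
  have b2: "\<beta> * ln (real r) - \<gamma> < 0" using \<beta>(2) lr by (simp add: field_simps)
  have "0 < \<beta>" using \<beta>(1) P by (meson divide_pos_pos less_trans zero_less_numeral)
  have "((\<lambda>N. 2 * real N powr (2 - P * \<beta>)) \<longlongrightarrow> 2 * 0) sequentially"
    by (intro tendsto_mult tendsto_const tendsto_neg_powr[OF b1] filterlim_real_sequentially)
  then have e1: "\<forall>\<^sub>F N in sequentially. 2 * real N powr (2 - P * \<beta>) < 1"
    by (rule order_tendstoD) simp
  have "((\<lambda>N. (\<bar>K\<bar> * real r) * real N powr (\<beta> * ln (real r) - \<gamma>)) \<longlongrightarrow> (\<bar>K\<bar> * real r) * 0) sequentially"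
    by (intro tendsto_mult tendsto_const tendsto_neg_powr[OF b2] filterlim_real_sequentially)
  then have e2: "\<forall>\<^sub>F N in sequentially. (\<bar>K\<bar> * real r) * real N powr (\<beta> * ln (real r) - \<gamma>) < 1"
    by (rule order_tendstoD) simp
  show ?thesis
    using e1 e2 eventually_gt_at_top[of 0]
  proof eventually_elim
    case (elim N)
    define m where "m = nat \<lceil>\<beta> * ln (real N)\<rceil>"
    have N1: "1 \<le> real N" using elim(3) by simp
    then have "0 \<le> \<beta> * ln (real N)" using \<open>0 < \<beta>\<close> by simp
    then have m: "\<beta> * ln (real N) \<le> real m" "real m \<le> \<beta> * ln (real N) + 1"
      unfolding m_def by linarith+
    have "p ^ m = exp (- (P * real m))"
      using p by (simp add: P_def exp_of_nat2_mult)
    also have "\<dots> \<le> exp (- (P * (\<beta> * ln (real N))))" using m(1) P by simp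
    also have "\<dots> = real N powr (- (P * \<beta>))" using N1 by (simp add: powr_def mult.assoc)
    finally have "2 * real N ^ 2 * p ^ m \<le> 2 * (real N powr 2 * real N powr (- (P * \<beta>)))"
      using N1 by (simp add: mult_left_mono)
    also have "\<dots> = 2 * real N powr (2 - P * \<beta>)" by (simp only: powr_add[symmetric] diff_conv_add_uminus)
    finally have 1: "2 * real N ^ 2 * p ^ m < 1" using elim(1) by linarith
    have "real r ^ m = exp (ln (real r) * real m)"
      using r by (simp add: exp_of_nat2_mult)
    also have "\<dots> \<le> exp (ln (real r) * (\<beta> * ln (real N) + 1))" using m(2) lr by simp
    also have "\<dots> = real r * real N powr (\<beta> * ln (real r))"
      using N1 r by (simp add: powr_def algebra_simps exp_add)
    finally have "\<bar>K\<bar> * real r ^ m \<le> \<bar>K\<bar> * (real r * real N powr (\<beta> * ln (real r)))"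
      by (rule mult_left_mono) simp
    also have "\<dots> = ((\<bar>K\<bar> * real r) * real N powr (\<beta> * ln (real r) - \<gamma>)) * real N powr \<gamma>"
      using N1 by (simp add: powr_diff)
    also have "\<dots> \<le> 1 * real N powr \<gamma>" using elim(2) by (intro mult_right_mono) auto
    finally have "\<bar>K\<bar> * real r ^ m \<le> real N powr \<gamma>" by simp
    moreover have "K * real r ^ m \<le> \<bar>K\<bar> * real r ^ m" by (intro mult_right_mono) auto
    ultimately have "K * real r ^ m \<le> real N powr \<gamma>" by linarith
    with 1 show ?case by blast
  qed
qed

text \<open>Here \<kappa> stands for \<open>k\<close>, and the sum is the failure rate of one round
  at density \<open>1 / s\<close>. It is at most
  \<open>(\<kappa> + 2) * s powr (\<kappa> - C)\<close>, while the squared number of colours is at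
  most \<open>4 * s ^ 4\<close>, so the product decays because
  \<open>4 + (\<kappa> - C) * \<gamma>\<close> is negative.\<close>

lemma eventually_density_small:
  fixes \<kappa> C \<gamma> :: real
  assumes \<gamma>: "\<gamma> > 0" and e: "\<gamma> * (C - \<kappa>) > 4" and \<kappa>: "\<kappa> \<ge> 0"
  shows "\<forall>\<^sub>F s in sequentially. \<kappa> * exp (- real s) + 2 * real s powr (\<kappa> - C) < 1 \<and>
    (real s ^ 2 + 1) ^ 2 * (\<kappa> * exp (- real s) + 2 * real s powr (\<kappa> - C)) powr \<gamma> < 1"
proof -
  have neg: "\<kappa> - C < 0" using e \<gamma> by (smt (verit) mult_nonneg_nonpos)
  have "((\<lambda>s. (\<kappa> + 2) * real s powr (\<kappa> - C)) \<longlongrightarrow> (\<kappa> + 2) * 0) sequentially"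
    by (intro tendsto_mult tendsto_const tendsto_neg_powr[OF neg] filterlim_real_sequentially)
  then have e1: "\<forall>\<^sub>F s in sequentially. (\<kappa> + 2) * real s powr (\<kappa> - C) < 1"
    by (rule order_tendstoD) simp
  have neg2: "4 + (\<kappa> - C) * \<gamma> < 0" using e by (simp add: algebra_simps)
  have "((\<lambda>s. (4 * (\<kappa> + 2) powr \<gamma>) * real s powr (4 + (\<kappa> - C) * \<gamma>)) \<longlongrightarrow> (4 * (\<kappa> + 2) powr \<gamma>) * 0) sequentially"
    by (intro tendsto_mult tendsto_const tendsto_neg_powr[OF neg2] filterlim_real_sequentially)
  then have e2: "\<forall>\<^sub>F s in sequentially. (4 * (\<kappa> + 2) powr \<gamma>) * real s powr (4 + (\<kappa> - C) * \<gamma>) < 1"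
    by (rule order_tendstoD) simp
  have "\<forall>\<^sub>F s in at_top. exp (- s) \<le> s powr (\<kappa> - C)" by real_asymp
  then have e3: "\<forall>\<^sub>F s in sequentially. exp (- real s) \<le> real s powr (\<kappa> - C)"
    using filterlim_real_sequentially by (rule eventually_compose_filterlim)
  show ?thesis
    using e1 e2 e3 eventually_gt_at_top[of 0]
  proof eventually_elim
    case (elim s)
    let ?q = "\<kappa> * exp (- real s) + 2 * real s powr (\<kappa> - C)"
    have s1: "1 \<le> real s" using elim(4) by simp
    have q: "?q \<le> (\<kappa> + 2) * real s powr (\<kappa> - C)"
      using mult_left_mono[OF elim(3) \<kappa>] by (simp add: algebra_simps)
    have q0: "0 \<le> ?q" using \<kappa> by simp
    have "real s ^ 2 + 1 \<le> 2 * real s ^ 2" using s1 by simp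
    then have "(real s ^ 2 + 1) ^ 2 \<le> (2 * real s ^ 2) ^ 2" by (intro power_mono) auto
    also have "\<dots> = 4 * real s powr 4" using s1 by (simp add: power_mult_distrib power_mult[symmetric])
    finally have "(real s ^ 2 + 1) ^ 2 * ?q powr \<gamma> \<le>
        (4 * real s powr 4) * ((\<kappa> + 2) * real s powr (\<kappa> - C)) powr \<gamma>"
      using q q0 \<gamma> by (intro mult_mono powr_mono2) auto
    also have "\<dots> = (4 * (\<kappa> + 2) powr \<gamma>) * real s powr (4 + (\<kappa> - C) * \<gamma>)"
      using \<kappa> by (simp add: powr_mult powr_powr powr_add)
    finally show ?case using elim(1,2) q by linarith
  qed
qed


theorem theorem2p9:
  fixes k :: nat and C \<alpha>\<^sub>0 \<gamma> :: real
  assumes "k \<ge> 4" and "even k"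
    and "C > 0" and "\<alpha>\<^sub>0 > 0"
    and "\<And>\<alpha>. 0 < \<alpha> \<Longrightarrow> \<alpha> < \<alpha>\<^sub>0 \<Longrightarrow> rho k \<alpha> \<le> \<alpha> powr C"
    and "C / (2 * real k) - 3 * real k / 4 > 0"
    and "\<gamma> > 1 / (C / (2 * real k) - 3 * real k / 4)"
  shows "\<forall>\<^sub>F N in sequentially.
           \<exists>c. c \<in> {..<N} \<rightarrow> {..<nat \<lceil>real N powr \<gamma>\<rceil>} \<and> \<not> has_symmetric_AP N k c"
proof -
  define E where "E = C / (2 * real k) - 3 * real k / 4"
  have E: "E > 0" "\<gamma> > 1 / E" using assms(6,7) by (simp_all add: E_def)
  then have "0 < 1 / E" by simp
  with E(2) have \<gamma>: "\<gamma> > 0" by linarith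
  have k2: "k \<ge> 2" using assms(1) by simp
  \<comment> \<open>From \<open>k \<ge> 4\<close> follows \<open>4 * E < C - k\<close>, so the
    exponent of the theorem exceeds the \<open>4 / (C - k)\<close> that the rounds cost.\<close>
  have "4 * E = 2 * C / real k - 3 * real k" using assms(1) by (simp add: E_def field_simps)
  also have "2 * C / real k \<le> 2 * C / 4" using assms(1,3) by (intro divide_left_mono) auto
  also have "2 * C / 4 - 3 * real k < C - real k" using assms(1,3) by simp
  finally have "\<gamma> * (4 * E) < \<gamma> * (C - real k)" using \<gamma> by simp
  moreover have "1 < \<gamma> * E" using E by (simp add: field_simps)
  ultimately have exponent: "\<gamma> * (C - real k) > 4" by linarith
  have small: "\<forall>\<^sub>F s in sequentially. 1 / real s < \<alpha>\<^sub>0"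
    using order_tendstoD(2)[OF lim_1_over_n assms(4)] .
  have "\<exists>s. s > 0 \<and> 1 / real s < \<alpha>\<^sub>0 \<and>
      real k * exp (- real s) + 2 * real s powr (real k - C) < 1 \<and>
      (real s ^ 2 + 1) ^ 2 * (real k * exp (- real s) + 2 * real s powr (real k - C)) powr \<gamma> < 1"
    by (rule eventually_happens'[OF sequentially_bot])
      (intro eventually_conj eventually_gt_at_top small eventually_density_small \<gamma> exponent of_nat_0_le_iff)
  then obtain s :: nat where s: "s > 0" "1 / real s < \<alpha>\<^sub>0"
    and q: "real k * exp (- real s) + 2 * real s powr (real k - C) < 1"
      "(real s ^ 2 + 1) ^ 2 * (real k * exp (- real s) + 2 * real s powr (real k - C)) powr \<gamma> < 1"
    by blast
  \<comment> \<open>The reciprocal of an integer makes \<open>M\<close>, the inverse square of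
    \<alpha>, a natural number, and for even \<open>k\<close> the number of patterns is then exactly
    \<open>s ^ k\<close>.\<close>
  define \<alpha> where "\<alpha> = 1 / real s"
  define M where "M = s ^ 2"
  define p where "p = real k * exp (- real s) + 2 * real s powr (real k - C)"
  have \<alpha>: "0 < \<alpha>" "\<alpha> \<le> 1" "\<alpha> < \<alpha>\<^sub>0" using s by (simp_all add: \<alpha>_def)
  have p: "0 < p" using assms(1) unfolding p_def by (intro add_pos_nonneg) auto
  \<comment> \<open>The infimum need not be attained; the factor 2 gives the strict inequality that
    produces \<open>F\<close>.\<close>
  have "rho k \<alpha> < 2 * \<alpha> powr C"
    using assms(5)[OF \<alpha>(1,3)] powr_gt_zero[of \<alpha> C] \<alpha>(1) by linarith
  moreover have "Lambda k ` {F. admissible \<alpha> F} \<noteq> {}"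
    using admissible_const[of \<alpha>] \<alpha>(1,2) by fastforce
  ultimately have "\<exists>x\<in>Lambda k ` {F. admissible \<alpha> F}. x < 2 * \<alpha> powr C"
    unfolding rho_def by (intro cInf_lessD)
  then obtain F where F: "admissible \<alpha> F" "Lambda k F < 2 * \<alpha> powr C" by blast
  have "(1 - \<alpha>) ^ M \<le> exp (- \<alpha>) ^ M"
    using \<alpha> exp_ge_add_one_self[of "- \<alpha>"] by (intro power_mono) simp_all
  also have "\<dots> = exp (- \<alpha> * real M)" by (rule exp_of_nat2_mult[symmetric])
  also have "- \<alpha> * real M = - real s" using s by (simp add: \<alpha>_def M_def power2_eq_square)
  finally have uncovered: "(1 - \<alpha>) ^ M \<le> exp (- real s)" .
  have "real (M ^ (k div 2)) * (2 * \<alpha> powr C) = 2 * real s powr (real k - C)"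
  proof -
    have "M ^ (k div 2) = s ^ k" using assms(2) by (simp add: M_def power_mult[symmetric])
    moreover have "real s ^ k = real s powr real k" using s by (simp add: powr_realpow)
    moreover have "\<alpha> powr C = 1 / real s powr C" using s by (simp add: \<alpha>_def powr_divide)
    ultimately show ?thesis by (simp add: powr_diff)
  qed
  with mult_left_mono[OF uncovered, of "real k"] have le_p: "real k * (1 - \<alpha>) ^ M + real (M ^ (k div 2)) * (2 * \<alpha> powr C) \<le> p"
    unfolding p_def by simp
  have step: "\<exists>c. (\<forall>x. c x \<le> M) \<and> real (card {nd \<in> B. sym_AP k c nd}) \<le> p * real (card B)"
    if B: "finite B" "\<And>nd. nd \<in> B \<Longrightarrow> snd nd \<noteq> 0" for B
  proof -
    have "M > 0" using s by (simp add: M_def)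
    from exists_coloring_step[OF k2 assms(2) F(1) this F(2) B] obtain c where c: "\<forall>x. c x \<le> M"
      and le: "real (card {nd \<in> B. sym_AP k c nd}) \<le>
        (real k * (1 - \<alpha>) ^ M + real (M ^ (k div 2)) * (2 * \<alpha> powr C)) * real (card B)" by blast
    note le
    also have "\<dots> \<le> p * real (card B)" by (intro mult_right_mono le_p) simp
    finally show ?thesis using c by blast
  qed
  have "\<forall>\<^sub>F N in sequentially. \<exists>m. 2 * real N ^ 2 * p ^ m < 1 \<and> real (2 * k) * real (M + 1) ^ m \<le> real N powr \<gamma>"
  proof (rule eventually_number_of_rounds[OF p _ _ _ \<gamma>])
    show "p < 1" using q(1) by (simp only: p_def)
    show "M + 1 > 1" using s by (simp add: M_def)
    have "real (M + 1) = real s ^ 2 + 1" by (simp add: M_def)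
    then show "real (M + 1) ^ 2 * p powr \<gamma> < 1" using q(2) by (simp only: p_def)
  qed
  then show ?thesis
    using eventually_gt_at_top[of 0]
  proof eventually_elim
    case (elim N)
    then obtain m where m: "2 * real N ^ 2 * p ^ m < 1" "real (2 * k) * real (M + 1) ^ m \<le> real N powr \<gamma>" by blast
    \<comment> \<open>Differences of both signs are included because the unwrapped progression may
      run backwards.\<close>
    define B where "B = {0..<int N} \<times> ({- int N<..<int N} - {0})"
    have B: "snd nd \<noteq> 0" if "nd \<in> B" for nd using that by (auto simp: B_def)
    have finB: "finite B" by (simp add: B_def)
    have "card B \<le> N * (2 * N)"
    proof -
      have "card ({- int N<..<int N} - {0}) \<le> card {- int N<..<int N}" by (intro card_mono) auto
      also have "\<dots> \<le> 2 * N" by simp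
      finally have *: "card ({- int N<..<int N} - {0}) \<le> 2 * N" .
      show ?thesis unfolding B_def card_cartesian_product by (rule mult_le_mono[OF _ *]) simp
    qed
    then have "real (card B) \<le> real (N * (2 * N))" by (simp only: of_nat_le_iff)
    then have cardB: "real (card B) \<le> 2 * real N ^ 2" by (simp add: power2_eq_square)
    have "\<exists>c. (\<forall>x. c x < (M + 1) ^ m) \<and> real (card {nd \<in> B. sym_AP k c nd}) \<le> p ^ m * real (card B)"
    proof (rule exists_coloring_iterate)
      show "\<exists>c. (\<forall>x. c x \<le> M) \<and> real (card {nd \<in> B'. sym_AP k c nd}) \<le> p * real (card B')"
        if "finite B'" "\<And>nd. nd \<in> B' \<Longrightarrow> snd nd \<noteq> 0" for B'
        using that by (rule step)
    qed (use p finB B in simp_all)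
    then obtain c where c: "\<And>x. c x < (M + 1) ^ m" "real (card {nd \<in> B. sym_AP k c nd}) \<le> p ^ m * real (card B)"
      by blast
    note c(2)
    also have "p ^ m * real (card B) \<le> p ^ m * (2 * real N ^ 2)"
      using cardB p by (intro mult_left_mono) auto
    also have "\<dots> < 1" using m(1) by (simp add: mult.commute)
    \<comment> \<open>A natural number below 1 is 0: after \<open>m\<close> rounds no symmetric
      progression is left.\<close>
    finally have "card {nd \<in> B. sym_AP k c nd} = 0" by simp
    then have "{nd \<in> B. sym_AP k c nd} = {}" using finB by simp
    then have none: "\<not> sym_AP k c (n, d)" if "0 \<le> n" "n < int N" "d \<noteq> 0" "\<bar>d\<bar> < int N" for n d
    proof -
      have "(n, d) \<in> B" using that by (auto simp: B_def)
      with \<open>{nd \<in> B. sym_AP k c nd} = {}\<close> show ?thesis by blast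
    qed
    let ?R = "(M + 1) ^ m"
    let ?c = "\<lambda>x. (x * (2 * k) div N) * ?R + c (int x)"
    have "?c x < nat \<lceil>real N powr \<gamma>\<rceil>" if "x < N" for x
    proof -
      have "x * (2 * k) < 2 * k * N" using that k2 by simp
      then have "x * (2 * k) div N < 2 * k" by (rule less_mult_imp_div_less)
      then have "(x * (2 * k) div N + 1) * ?R \<le> 2 * k * ?R" by (intro mult_right_mono) auto
      then have "?c x < 2 * k * ?R"
        unfolding add_mult_distrib mult_1 using c(1)[of "int x"] by linarith
      moreover have "real (2 * k * ?R) \<le> real N powr \<gamma>" using m(2) by simp
      ultimately show ?thesis by linarith
    qed
    moreover have "\<not> has_symmetric_AP N k ?c"
      by (rule no_symmetric_AP_blocks[OF k2 assms(2) c(1) none])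
    ultimately show ?case by (intro exI[of _ ?c] conjI Pi_I) simp_all
  qed
qed

end
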